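(* Let $V_1,V_2$ be Orlicz functions such that $V_1(x)/V_2(x)\to\infty$ as $|x|\to\infty$ and $\int_{\mathbb R}V_1(x)e^{\alpha V_2(x)}dx<\infty$ for all $\alpha\in(-\infty,0)$. For each $n$ let $X_1^{n,V_1}$ be uniformly distributed on $\mathbb B_1^{n,V_1}$. Then there exists $\overline R\in(0,\infty)$ such that for all $0<R\le\overline R$ and every fixed $k\in\mathbb N$, $$\lim_{\epsilon\to0}\lim_{n\to\infty}d_w\big(\lambda^{(n,k)}_{R,\epsilon},\,\lambda^{(n,k)}_{R,V_2}\big)=0,$$ where $\lambda^{(n,k)}_{R,\epsilon}:=P\big[(X_1^{n,V_1}(1),\dots,X_1^{n,V_1}(k))\in\cdot\,\big|\,X_1^{n,V_1}\in\mathbb B^{n,V_2}_{R+\epsilon}\big]$, $\lambda^{(n,k)}_{R,V_2}$ is the distribution of the first $k$ coordinates of a random vector uniformly distributed on $\mathbb B^{n,V_2}_R$, and $d_w$ is a metric inducing weak convergence of probability measures on $\mathbb R^k$.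
   Context: An Orlicz function is a convex, symmetric function $V:\mathbb R\to[0,\infty)$ with $V(0)=0$ and $V(x)>0$ for $x\neq0$. For $R>0$, $\mathbb B_R^{n,V}:=\{x\in\mathbb R^n:\sum_{k=1}^nV(x_k)\le Rn\}$. *)

theory Defs
  imports "HOL-Probability.Probability"
begin

definition orlicz :: "(real \<Rightarrow> real) \<Rightarrow> bool" where
  "orlicz V \<longleftrightarrow> convex_on UNIV V \<and> (\<forall>x. V (-x) = V x) \<and> (\<forall>x. V x \<ge> 0)
     \<and> V 0 = 0 \<and> (\<forall>x. x \<noteq> 0 \<longrightarrow> V x > 0)"

definition Rn :: "nat \<Rightarrow> (nat \<Rightarrow> real) measure" where
  "Rn n = PiM {..<n} (\<lambda>_. lborel)"

definition orlicz_ball :: "(real \<Rightarrow> real) \<Rightarrow> nat \<Rightarrow> real \<Rightarrow> (nat \<Rightarrow> real) set" where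
  "orlicz_ball V n R = {x \<in> space (Rn n). (\<Sum>i<n. V (x i)) \<le> R * real n}"

text \<open>Law of the first k coordinates (coordinates 1..k of the paper are 0..k-1 here).\<close>
definition first_coords :: "nat \<Rightarrow> (nat \<Rightarrow> real) measure \<Rightarrow> (nat \<Rightarrow> real) measure" where
  "first_coords k M = distr M (Rn k) (\<lambda>x. restrict x {..<k})"

definition lam_cond :: "(real \<Rightarrow> real) \<Rightarrow> (real \<Rightarrow> real) \<Rightarrow> nat \<Rightarrow> nat \<Rightarrow> real \<Rightarrow> real
    \<Rightarrow> (nat \<Rightarrow> real) measure" where
  "lam_cond V1 V2 n k R \<epsilon> = first_coords k
     (uniform_measure (uniform_measure (Rn n) (orlicz_ball V1 n 1)) (orlicz_ball V2 n (R + \<epsilon>)))"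

definition lam_unif :: "(real \<Rightarrow> real) \<Rightarrow> nat \<Rightarrow> nat \<Rightarrow> real \<Rightarrow> (nat \<Rightarrow> real) measure" where
  "lam_unif V n k R = first_coords k (uniform_measure (Rn n) (orlicz_ball V n R))"

text \<open>Bounded-Lipschitz (Fortet-Mourier) metric on probability measures on R^k;
  it metrizes weak convergence.\<close>
definition dBL :: "nat \<Rightarrow> (nat \<Rightarrow> real) measure \<Rightarrow> (nat \<Rightarrow> real) measure \<Rightarrow> real" where
  "dBL k \<mu> \<nu> = (SUP f \<in> {f. f \<in> borel_measurable (Rn k) \<and> (\<forall>x. \<bar>f x\<bar> \<le> 1)
        \<and> (\<forall>x y. \<bar>f x - f y\<bar> \<le> sqrt (\<Sum>i<k. (x i - y i)\<^sup>2))}.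
      \<bar>(\<integral>x. f x \<partial>\<mu>) - (\<integral>x. f x \<partial>\<nu>)\<bar>)"

end

theory Submission
  imports Defs
begin

text \<open>
  Let \<open>p\<^sub>a\<close> be the probability density proportional to \<open>exp (- a V2)\<close>, with normalising constant
  \<open>Z a\<close>, and choose \<open>a\<close> so that \<open>V2\<close> has mean \<open>R\<close> under \<open>p\<^sub>a\<close>. On the ball of \<open>V2\<close> the density of
  \<open>p\<^sub>a\<^sup>n\<close> is at least \<open>(Z a * exp (a R))\<^sup>-\<^sup>n\<close>. Conversely, tilting the parameter slightly shows that
  the volume of the ball, even when it is cut with the unit ball of \<open>V1\<close>, is at least
  \<open>(Z a * exp (a R))\<^sup>n\<close> up to a factor \<open>exp (- o(n))\<close>; the cut is harmless because for large \<open>a\<close>, that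
  is for small \<open>R\<close>, the mean of \<open>V1\<close> is at most 1/2, so that Markov's inequality suffices. Hence
  every event has, under the uniform distribution on the body, at most \<open>exp (o(n))\<close> times its
  \<open>p\<^sub>a\<^sup>n\<close>-probability.

  By Hoeffding's inequality, averages of a bounded function of \<open>k\<close> coordinates over disjoint blocks
  of coordinates deviate from their \<open>p\<^sub>a\<^sup>n\<close>-mean only with exponentially small probability, so they
  concentrate under the uniform distribution as well. By exchangeability the first \<open>k\<close> coordinates
  converge to \<open>p\<^sub>a\<^sup>k\<close>, uniformly over test functions bounded by 1. The limit in \<open>n\<close> of the distance
  in the theorem is therefore the distance of \<open>p\<^sub>b\<^sup>k\<close> and \<open>p\<^sub>a\<^sup>k\<close> with \<open>b\<close> belonging to
  \<open>R + \<epsilon>\<close>, and \<open>b\<close> tends to \<open>a\<close> as \<open>\<epsilon>\<close> tends to 0.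
\<close>

section \<open>The one-dimensional Gibbs measures\<close>

definition partition_fn :: "(real \<Rightarrow> real) \<Rightarrow> real \<Rightarrow> real" where
  "partition_fn V a = (\<integral>x. exp (- a * V x) \<partial>lborel)"

text \<open>The weight \<open>W\<close> is kept apart from \<open>V\<close> because the measure
  built from \<open>V2\<close> has to average both \<open>V2\<close> and \<open>V1\<close>.\<close>

definition gibbs_mean :: "(real \<Rightarrow> real) \<Rightarrow> real \<Rightarrow> (real \<Rightarrow> real) \<Rightarrow> real" where
  "gibbs_mean V a W = (\<integral>x. W x * exp (- a * V x) \<partial>lborel) / partition_fn V a"

section \<open>Orlicz functions: monotonicity, linear growth and integrability\<close>

lemma orlicz_continuous:
  assumes "orlicz V" shows "continuous_on UNIV V"
  using assms unfolding orlicz_def by (intro convex_on_continuous) auto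

lemma orlicz_measurable: "orlicz V \<Longrightarrow> V \<in> borel_measurable borel"
  by (intro borel_measurable_continuous_onI orlicz_continuous)

text \<open>Convexity and \<open>V 0 = 0\<close> give \<open>V (t * y) \<le> t * V y\<close> for
  \<open>t\<close> in \<open>[0,1]\<close>; symmetry reduces everything to absolute values.\<close>

lemma orlicz_mono_abs:
  assumes "orlicz V" "\<bar>x\<bar> \<le> \<bar>y\<bar>" shows "V x \<le> V y"
proof -
  have ab: "V \<bar>z\<bar> = V z" for z using assms(1) by (simp add: orlicz_def abs_if)
  have "V \<bar>x\<bar> \<le> V \<bar>y\<bar>"
  proof (cases "y = 0")
    case False
    define t where "t = \<bar>x\<bar> / \<bar>y\<bar>"
    have t: "0 \<le> t" "t \<le> 1" "\<bar>x\<bar> = t * \<bar>y\<bar>"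
      using False assms(2) by (auto simp: t_def)
    have "V ((1 - t) *\<^sub>R 0 + t *\<^sub>R \<bar>y\<bar>) \<le> (1 - t) * V 0 + t * V \<bar>y\<bar>"
      using assms(1) t unfolding orlicz_def by (intro convex_onD) auto
    also have "\<dots> = t * V \<bar>y\<bar>" using assms(1) by (simp add: orlicz_def)
    also have "\<dots> \<le> 1 * V \<bar>y\<bar>" using assms(1) t by (intro mult_right_mono) (auto simp: orlicz_def)
    finally show ?thesis using t by simp
  qed (use assms in auto)
  thus ?thesis by (simp add: ab)
qed

text \<open>For \<open>\<bar>x\<bar> > 1\<close> the chord from 0 to \<open>\<bar>x\<bar>\<close>
  lies above \<open>V\<close> at 1, which gives \<open>V x \<ge> V 1 * \<bar>x\<bar>\<close>. The
  shift by 1 makes the bound trivial on the remaining interval. This growth is what makes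
  \<open>exp (- a * V x)\<close> integrable.\<close>

lemma orlicz_linear_lower_bound:
  assumes "orlicz V" shows "V 1 * (\<bar>x\<bar> - 1) \<le> V x"
proof (cases "\<bar>x\<bar> \<le> 1")
  case True
  have "V 1 * (\<bar>x\<bar> - 1) \<le> 0" using True assms
    by (intro mult_nonneg_nonpos) (auto simp: orlicz_def)
  also have "0 \<le> V x" using assms by (auto simp: orlicz_def)
  finally show ?thesis .
next
  case False
  have ab: "V \<bar>x\<bar> = V x" using assms by (simp add: orlicz_def abs_if)
  define t where "t = 1 / \<bar>x\<bar>"
  have t: "0 \<le> t" "t \<le> 1" "1 = t * \<bar>x\<bar>" using False by (auto simp: t_def)
  have "V ((1 - t) *\<^sub>R 0 + t *\<^sub>R \<bar>x\<bar>) \<le> (1 - t) * V 0 + t * V \<bar>x\<bar>"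
    using assms t unfolding orlicz_def by (intro convex_onD) auto
  then have "V 1 \<le> t * V x" using assms t(3) ab by (simp add: orlicz_def)
  then have "V 1 * \<bar>x\<bar> \<le> V x" using False by (simp add: t_def field_simps)
  moreover have "V 1 \<ge> 0" using assms by (auto simp: orlicz_def)
  ultimately show ?thesis by (simp add: algebra_simps)
qed

lemma integrable_exp_minus_abs:
  fixes c :: real assumes "c > 0" shows "integrable lborel (\<lambda>x::real. exp (- c * \<bar>x\<bar>))"
proof -
  interpret prob_space "density lborel (exponential_density c)"
    using assms by (rule prob_space_exponential_density)
  have i: "integrable lborel (exponential_density c)"
  proof (rule integrableI_nonneg)
    show "(\<integral>\<^sup>+ x. ennreal (exponential_density c x) \<partial>lborel) < \<infinity>"
      using emeasure_space_1 by (simp add: emeasure_density)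
  qed (use assms in \<open>auto simp: exponential_density_nonneg\<close>)
  have j: "integrable lborel (\<lambda>x. exponential_density c (- x))"
    using lborel_integrable_real_affine[OF i, of "-1" 0] by simp
  \<comment> \<open>The exponential density plus its reflection, divided by \<open>c\<close>, equals
    the two-sided exponential away from 0 and is 2 at 0.\<close>
  have "integrable lborel (\<lambda>x. (exponential_density c x + exponential_density c (- x)) / c)"
    using i j by (intro integrable_divide_zero Bochner_Integration.integrable_add) auto
  then show ?thesis
    by (rule Bochner_Integration.integrable_bound)
       (use assms in \<open>auto simp: exponential_density_def mult.commute\<close>)
qed

lemma integrable_exp_orlicz:
  assumes "orlicz V" "a > 0"
  shows "integrable lborel (\<lambda>x. exp (- a * V x))"
proof -
  note orlicz_measurable[OF assms(1), measurable]
  have "V 1 > 0" using assms by (auto simp: orlicz_def)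
  then have "integrable lborel (\<lambda>x::real. exp (a * V 1) * exp (- (a * V 1) * \<bar>x\<bar>))"
    using assms by (intro integrable_mult_right integrable_exp_minus_abs) auto
  then show ?thesis
  proof (rule Bochner_Integration.integrable_bound)
    show "AE x in lborel. norm (exp (- a * V x)) \<le> norm (exp (a * V 1) * exp (- (a * V 1) * \<bar>x\<bar>))"
    proof (rule AE_I2)
      fix x
      have "a * (V 1 * (\<bar>x\<bar> - 1)) \<le> a * V x"
        using orlicz_linear_lower_bound[OF assms(1)] assms(2) by (intro mult_left_mono) auto
      then show "norm (exp (- a * V x)) \<le> norm (exp (a * V 1) * exp (- (a * V 1) * \<bar>x\<bar>))"
        by (simp add: exp_add[symmetric] algebra_simps)
    qed
  qed simp
qed

lemma integrable_orlicz_exp: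
  assumes "orlicz V" "a > 0"
  shows "integrable lborel (\<lambda>x. V x * exp (- a * V x))"
proof -
  note orlicz_measurable[OF assms(1), measurable]
  \<comment> \<open>Half of the exponent absorbs the factor \<open>V x\<close>, by
    \<open>y \<le> exp y\<close> at \<open>y = (a/2) * V x\<close>.\<close>
  have "integrable lborel (\<lambda>x. (2 / a) * exp (- (a/2) * V x))"
    using assms by (intro integrable_mult_right integrable_exp_orlicz) auto
  then show ?thesis
  proof (rule Bochner_Integration.integrable_bound)
    show "AE x in lborel. norm (V x * exp (- a * V x)) \<le> norm (2 / a * exp (- (a/2) * V x))"
    proof (rule AE_I2)
      fix x
      have 1: "V x \<ge> 0" using assms by (auto simp: orlicz_def)
      have "(a/2) * V x \<le> exp ((a/2) * V x)" using exp_ge_add_one_self[of "(a/2) * V x"] by linarith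
      then have "V x \<le> 2 / a * exp ((a/2) * V x)" using assms by (simp add: field_simps)
      then have "V x * exp (- a * V x) \<le> 2 / a * exp ((a/2) * V x) * exp (- a * V x)"
        by (intro mult_right_mono) auto
      also have "\<dots> = 2 / a * exp (- (a/2) * V x)" by (simp add: exp_add[symmetric])
      finally show "norm (V x * exp (- a * V x)) \<le> norm (2 / a * exp (- (a/2) * V x))"
        using 1 assms(2) by simp
    qed
  qed simp
qed

lemma orlicz_near_zero:
  assumes "orlicz V" "e > 0"
  obtains s where "s > 0" "\<And>x. \<bar>x\<bar> \<le> s \<Longrightarrow> V x < e"
proof -
  have "isCont V 0" using orlicz_continuous[OF assms(1)] by (simp add: continuous_on_eq_continuous_at)
  then obtain d where d: "d > 0" "\<And>x. dist x 0 < d \<Longrightarrow> dist (V x) (V 0) < e"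
    using assms(2) unfolding continuous_at_eps_delta by (auto simp: dist_norm)
  show ?thesis
  proof (rule that[of "d/2"])
    fix x :: real assume "\<bar>x\<bar> \<le> d/2"
    then have "dist (V x) (V 0) < e" using d by (intro d(2)) auto
    then show "V x < e" using assms by (auto simp: orlicz_def dist_real_def)
  qed (use d in auto)
qed

section \<open>The partition function and the mean as functions of the parameter\<close>

lemma partition_fn_pos:
  assumes "orlicz V" "a > 0" shows "partition_fn V a > 0"
proof -
  have "partition_fn V a \<ge> 0" unfolding partition_fn_def by (intro integral_nonneg_AE) auto
  moreover have "partition_fn V a \<noteq> 0"
  proof
    assume "partition_fn V a = 0"
    then have "AE x in lborel. exp (- a * V x) = 0"
      using integral_nonneg_eq_0_iff_AE[OF integrable_exp_orlicz[OF assms]]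
      by (simp add: partition_fn_def)
    then have "AE x in (lborel::real measure). False" by simp
    then show False by (simp add: ae_filter_eq_bot_iff eventually_False)
  qed
  ultimately show ?thesis by simp
qed

text \<open>Integrate \<open>1 + y \<le> exp y\<close> at \<open>y = (a - b) * (V x - R)\<close>
  against \<open>exp (- a * V x)\<close>; the linear term vanishes because the mean is
  \<open>R\<close>. Equality would force \<open>V = R\<close> almost everywhere. All exponential
  decay of Gibbs probabilities of level sets of \<open>V\<close> comes from this strictness.\<close>

lemma partition_fn_strict_min:
  assumes V: "orlicz V" and a: "a > 0" and b: "b > 0" "b \<noteq> a" and R: "R > 0"
    and mean: "gibbs_mean V a V = R"
  shows "partition_fn V a * exp (a * R) < partition_fn V b * exp (b * R)"
proof -
  note orlicz_measurable[OF V, measurable]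
  define h where "h = (\<lambda>x. (exp ((a - b) * (V x - R)) - 1 - (a - b) * (V x - R)) * exp (- a * V x))"
  have h_eq: "h x = exp ((b - a) * R) * exp (- b * V x) - exp (- a * V x)
      - ((a - b) * (V x * exp (- a * V x)) - (a - b) * R * exp (- a * V x))" for x
  proof -
    have "exp ((a - b) * (V x - R)) * exp (- a * V x) = exp ((b - a) * R) * exp (- b * V x)"
      by (simp add: exp_add[symmetric] algebra_simps)
    then show ?thesis by (simp add: h_def algebra_simps)
  qed
  note I = integrable_exp_orlicz[OF V a] integrable_exp_orlicz[OF V b(1)] integrable_orlicz_exp[OF V a]
  have int_h: "integrable lborel h" unfolding h_eq[abs_def]
    by (intro Bochner_Integration.integrable_diff integrable_mult_right I)
  have m: "(\<integral>x. V x * exp (- a * V x) \<partial>lborel) = R * partition_fn V a"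
    using mean partition_fn_pos[OF V a] by (simp add: gibbs_mean_def field_simps)
  have "has_bochner_integral lborel h (exp ((b - a) * R) * partition_fn V b - partition_fn V a
      - ((a - b) * (R * partition_fn V a) - (a - b) * R * partition_fn V a))"
    unfolding h_eq[abs_def] m[symmetric] unfolding partition_fn_def
    by (intro has_bochner_integral_diff has_bochner_integral_mult_right has_bochner_integral_integrable I)
  from has_bochner_integral_integral_eq[OF this]
have ih: "integral\<^sup>L lborel h = exp ((b - a) * R) * partition_fn V b - partition_fn V a" by simp
  have h_nn: "h x \<ge> 0" for x
    unfolding h_def using exp_ge_add_one_self[of "(a - b) * (V x - R)"]
    by (intro mult_nonneg_nonneg) (linarith, rule exp_ge_zero)
  have "integral\<^sup>L lborel h \<noteq> 0"
  proof
    assume "integral\<^sup>L lborel h = 0"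
    then have "AE x in lborel. h x = 0"
      using integral_nonneg_eq_0_iff_AE[OF int_h] h_nn by auto
    then have AE_R: "AE x in lborel. V x = R"
    proof eventually_elim
      case (elim x)
      then have "exp ((a - b) * (V x - R)) = 1 + (a - b) * (V x - R)" by (simp add: h_def)
      then have "(a - b) * (V x - R) = 0"
        using ln_eq_minus_one[OF exp_gt_zero, of "(a - b) * (V x - R)"]
        by (metis add_diff_cancel_left' exp_eq_one_iff ln_exp)
      then show ?case using b by simp
    qed
    \<comment> \<open>Near 0 the function \<open>V\<close> stays below \<open>R\<close> on an
      interval of positive length.\<close>
    obtain s where s: "s > 0" "\<And>x. \<bar>x\<bar> \<le> s \<Longrightarrow> V x < R"
      using orlicz_near_zero[OF V R] by blast
    from AE_R have "AE x in lborel. x \<notin> {-s..s}"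
      by eventually_elim (use s(2) in \<open>force simp: abs_le_iff\<close>)
    then have "emeasure lborel {-s..s} = 0"
      by (subst (asm) AE_iff_null_sets[symmetric]) auto
    then show False using s(1) by simp
  qed
  moreover have "integral\<^sup>L lborel h \<ge> 0" using h_nn by (intro integral_nonneg_AE) auto
  ultimately have "partition_fn V a < exp ((b - a) * R) * partition_fn V b" using ih by linarith
  then have "exp (a * R) * partition_fn V a < exp (a * R) * (exp ((b - a) * R) * partition_fn V b)"
    by simp
  also have "\<dots> = partition_fn V b * exp (b * R)"
    by (simp add: exp_add[symmetric] algebra_simps flip: mult.assoc)
  finally show ?thesis by (simp add: mult.commute)
qed

lemma gibbs_mean_pos:
  assumes V: "orlicz V" and a: "a > 0" shows "gibbs_mean V a V > 0"
proof -
  note orlicz_measurable[OF V, measurable]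
  let ?f = "\<lambda>x. V x * exp (- a * V x)"
  have nn: "?f x \<ge> 0" for x using V by (auto simp: orlicz_def)
  have "integral\<^sup>L lborel ?f \<noteq> 0"
  proof
    assume "integral\<^sup>L lborel ?f = 0"
    then have "AE x in lborel. ?f x = 0"
      using integral_nonneg_eq_0_iff_AE[OF integrable_orlicz_exp[OF V a]] nn by auto
    then have "AE x in lborel. x \<notin> {1..2::real}"
    proof eventually_elim
      case (elim x)
      then have "V x = 0" by simp
      then have "x = 0" using V by (metis less_irrefl orlicz_def)
      then show ?case by simp
    qed
    then have "emeasure lborel {1..2::real} = 0"
      by (subst (asm) AE_iff_null_sets[symmetric]) auto
    then show False by simp
  qed
  moreover have "integral\<^sup>L lborel ?f \<ge> 0" using nn by (intro integral_nonneg_AE) auto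
  ultimately show ?thesis unfolding gibbs_mean_def
    using partition_fn_pos[OF V a] by (intro divide_pos_pos) auto
qed

text \<open>The strict minimum property is used twice, once with the mean of each parameter. If the
  means were ordered the wrong way, the two strict inequalities would contradict each other, so no
  derivative in the parameter has to be taken.\<close>

lemma gibbs_mean_strict_antimono:
  assumes V: "orlicz V" and a: "a > 0" and ab: "a < b"
  shows "gibbs_mean V b V < gibbs_mean V a V"
proof (rule ccontr)
  assume *: "\<not> ?thesis"
  have b: "b > 0" using a ab by simp
  define Ra Rb where "Ra = gibbs_mean V a V" and "Rb = gibbs_mean V b V"
  have 1: "partition_fn V a * exp (a * Ra) < partition_fn V b * exp (b * Ra)"
    using ab by (intro partition_fn_strict_min V a b) (auto simp: Ra_def gibbs_mean_pos V a)
  have 2: "partition_fn V b * exp (b * Rb) < partition_fn V a * exp (a * Rb)"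
    using ab by (intro partition_fn_strict_min V a b) (auto simp: Rb_def gibbs_mean_pos V b)
  have "partition_fn V b * exp (b * Ra) = partition_fn V b * exp (b * Rb) * exp (- b * (Rb - Ra))"
    by (simp add: exp_add[symmetric] algebra_simps flip: mult.assoc)
  also have "\<dots> \<le> partition_fn V a * exp (a * Rb) * exp (- b * (Rb - Ra))"
    using 2 by (intro mult_right_mono) auto
  also have "\<dots> = partition_fn V a * exp (a * Ra) * exp (- (b - a) * (Rb - Ra))"
    by (simp add: exp_add[symmetric] algebra_simps flip: mult.assoc)
  also have "\<dots> \<le> partition_fn V a * exp (a * Ra) * 1"
    using partition_fn_pos[OF V a] * ab
    by (intro mult_left_mono) (auto simp: Ra_def Rb_def mult_nonpos_nonneg)
  finally show False using 1 by simp
qed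

text \<open>Dominated convergence along sequences. The set \<open>S\<close> serves to keep the
  parameter away from 0, where no common integrable bound is at hand.\<close>

lemma continuous_on_integral_dominated:
  fixes g :: "real \<Rightarrow> 'b \<Rightarrow> real"
  assumes meas: "\<And>a. a \<in> S \<Longrightarrow> g a \<in> borel_measurable M"
    and h: "integrable M h"
    and bound: "\<And>a x. a \<in> S \<Longrightarrow> \<bar>g a x\<bar> \<le> h x"
    and cont: "\<And>x. continuous_on S (\<lambda>a. g a x)"
  shows "continuous_on S (\<lambda>a. \<integral>x. g a x \<partial>M)"
  unfolding continuous_on_sequentially
proof (intro allI ballI impI)
  fix u a assume a: "a \<in> S" and u: "(\<forall>n. u n \<in> S) \<and> u \<longlonglongrightarrow> a"
  have "(\<lambda>n. \<integral>x. g (u n) x \<partial>M) \<longlonglongrightarrow> (\<integral>x. g a x \<partial>M)"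
  proof (rule integral_dominated_convergence[where w = h])
    show "AE x in M. (\<lambda>n. g (u n) x) \<longlonglongrightarrow> g a x"
    proof (rule AE_I2)
      fix x
      from cont[of x] show "(\<lambda>n. g (u n) x) \<longlonglongrightarrow> g a x"
        unfolding continuous_on_sequentially comp_def using a u by blast
    qed
  qed (use meas a u h bound in auto)
  then show "((\<lambda>a. \<integral>x. g a x \<partial>M) \<circ> u) \<longlonglongrightarrow> (\<integral>x. g a x \<partial>M)" by (simp add: comp_def)
qed

lemma exp_orlicz_antimono:
  assumes "orlicz V" "c \<le> a" shows "exp (- a * V x) \<le> exp (- c * V x)"
  using assms by (simp add: orlicz_def mult_right_mono)

lemma continuous_on_partition_fn:
  assumes V: "orlicz V" and c: "c > 0" shows "continuous_on {c..} (partition_fn V)"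
  unfolding partition_fn_def[abs_def]
proof (rule continuous_on_integral_dominated[OF _ integrable_exp_orlicz[OF V c]])
  show "continuous_on {c..} (\<lambda>a. exp (- a * V x))" for x by (intro continuous_intros)
qed (use orlicz_measurable[OF V] exp_orlicz_antimono[OF V] in auto)

lemma continuous_on_gibbs_mean:
  assumes V: "orlicz V" and c: "c > 0" shows "continuous_on {c..} (\<lambda>a. gibbs_mean V a V)"
  unfolding gibbs_mean_def
proof (intro continuous_on_divide continuous_on_partition_fn V c)
  note orlicz_measurable[OF V, measurable]
  show "continuous_on {c..} (\<lambda>a. \<integral>x. V x * exp (- a * V x) \<partial>lborel)"
  proof (rule continuous_on_integral_dominated[OF _ integrable_orlicz_exp[OF V c]])
    show "continuous_on {c..} (\<lambda>a. V x * exp (- a * V x))" for x by (intro continuous_intros)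
    show "\<bar>V x * exp (- a * V x)\<bar> \<le> V x * exp (- c * V x)" if "a \<in> {c..}" for a x
      using that V exp_orlicz_antimono[OF V, of c a x]
      by (auto simp: abs_mult orlicz_def intro!: mult_left_mono)
  qed simp
  show "\<forall>a\<in>{c..}. partition_fn V a \<noteq> 0"
    using partition_fn_pos[OF V] c by (smt (verit) atLeast_iff)
qed

text \<open>For large \<open>a\<close> the mass concentrates at 0, where \<open>W\<close> vanishes.
  The numerator is split at \<open>\<bar>x\<bar> = s\<close>: inside, \<open>W\<close> is below
  \<open>e/2\<close>; outside, the weight decays like \<open>exp (- a * V s)\<close>, which beats
  the normalising constant.\<close>

lemma gibbs_mean_tendsto_0:
  assumes V: "orlicz V" and W: "orlicz W" and int: "\<And>a. a > 0 \<Longrightarrow> integrable lborel (\<lambda>x. W x * exp (- a * V x))"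
  shows "((\<lambda>a. gibbs_mean V a W) \<longlongrightarrow> 0) at_top"
proof (rule tendstoI)
  fix e :: real assume e: "e > 0"
  note orlicz_measurable[OF V, measurable] orlicz_measurable[OF W, measurable]
  have Wnn: "W x \<ge> 0" for x using W by (auto simp: orlicz_def)
  obtain s where s: "s > 0" "\<And>x. \<bar>x\<bar> \<le> s \<Longrightarrow> W x < e/2" using orlicz_near_zero[OF W, of "e/2"] e by auto
  have Vs: "V s > 0" using V s(1) by (auto simp: orlicz_def)
  \<comment> \<open>On \<open>[-t, t]\<close> one has \<open>V x < V s / 2\<close>, so the
    normalising constant decays at most at half the rate of the outer part.\<close>
  obtain t where t: "t > 0" "\<And>x. \<bar>x\<bar> \<le> t \<Longrightarrow> V x < V s/2" using orlicz_near_zero[OF V, of "V s/2"] Vs by auto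
  \<comment> \<open>One unit of the parameter is set aside for integrability; the remaining
    \<open>a - 1\<close> yields the decay for \<open>\<bar>x\<bar> > s\<close>.\<close>
  define K where "K = (\<integral>x. W x * exp (- 1 * V x) \<partial>lborel)"
  have Kle: "gibbs_mean V a W \<le> e/2 + exp (V s) * K / (2 * t) * exp (- (V s / 2) * a)" if a: "a > 1" for a
  proof -
    have a0: "a > 0" using a by simp
    have "(\<integral>x. W x * exp (- a * V x) \<partial>lborel) \<le>
        (\<integral>x. e/2 * exp (- a * V x) + exp (- (a - 1) * V s) * (W x * exp (- 1 * V x)) \<partial>lborel)"
    proof (rule integral_mono)
      fix x
      show "W x * exp (- a * V x) \<le> e/2 * exp (- a * V x) + exp (- (a - 1) * V s) * (W x * exp (- 1 * V x))"
      proof (cases "\<bar>x\<bar> \<le> s")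
        case True
        have "W x * exp (- a * V x) \<le> e/2 * exp (- a * V x)"
          using s(2)[OF True] by (intro mult_right_mono) auto
        then show ?thesis using Wnn[of x] by (smt (verit) exp_ge_zero mult_nonneg_nonneg)
      next
        case False
        have "V s \<le> V x" using False s(1) by (auto intro!: orlicz_mono_abs[OF V])
        then have "(a - 1) * V s \<le> (a - 1) * V x" using a by (intro mult_left_mono) auto
        then have "exp (- a * V x) \<le> exp (- (a - 1) * V s) * exp (- 1 * V x)"
          by (simp add: exp_add[symmetric] algebra_simps)
        then have "W x * exp (- a * V x) \<le> W x * (exp (- (a - 1) * V s) * exp (- 1 * V x))"
          using Wnn by (intro mult_left_mono) auto
        moreover have "e/2 * exp (- a * V x) \<ge> 0" using e by simp
        ultimately show ?thesis by (simp add: mult_ac)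
      qed
    qed (use int[OF a0] int[of 1] integrable_exp_orlicz[OF V a0] in auto)
    also have "\<dots> = e/2 * partition_fn V a + exp (- (a - 1) * V s) * K"
      using int[of 1] integrable_exp_orlicz[OF V a0] by (simp add: K_def partition_fn_def)
    finally have num: "(\<integral>x. W x * exp (- a * V x) \<partial>lborel) \<le> e/2 * partition_fn V a + exp (- (a - 1) * V s) * K" .
    have "(\<integral>x. exp (- a * (V s / 2)) * indicator {-t..t} x \<partial>lborel) \<le> partition_fn V a"
      unfolding partition_fn_def
    proof (rule integral_mono)
      fix x
      show "exp (- a * (V s / 2)) * indicator {-t..t} x \<le> exp (- a * V x)"
        using t(2)[of x] a0 by (auto simp: indicator_def abs_le_iff)
    qed (use integrable_exp_orlicz[OF V a0] t(1) in \<open>auto intro!: integrable_real_indicator\<close>)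
    then have Zlow: "exp (- a * (V s / 2)) * (2 * t) \<le> partition_fn V a" using t(1) by simp
    have Zp: "partition_fn V a > 0" by (rule partition_fn_pos[OF V a0])
    have K0: "K \<ge> 0" unfolding K_def using Wnn by (intro integral_nonneg_AE) auto
    have "gibbs_mean V a W \<le> (e/2 * partition_fn V a + exp (- (a - 1) * V s) * K) / partition_fn V a"
      unfolding gibbs_mean_def using num Zp by (intro divide_right_mono) auto
    also have "\<dots> = e/2 + exp (- (a - 1) * V s) * K / partition_fn V a"
      using Zp by (simp add: add_divide_distrib)
    also have "\<dots> \<le> e/2 + exp (- (a - 1) * V s) * K / (exp (- a * (V s / 2)) * (2 * t))"
      using Zlow K0 t(1) Zp by (intro add_left_mono divide_left_mono) auto
    also have "exp (- (a - 1) * V s) * K / (exp (- a * (V s / 2)) * (2 * t)) =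
        (exp (- (a - 1) * V s) / exp (- a * (V s / 2))) * K / (2 * t)" by simp
    also have "exp (- (a - 1) * V s) / exp (- a * (V s / 2)) = exp (V s) * exp (- (V s / 2) * a)"
      by (simp add: exp_diff[symmetric] exp_add[symmetric] algebra_simps)
    finally show ?thesis by (simp add: mult_ac)
  qed
  have "((\<lambda>a. exp (V s) * K / (2 * t) * exp (- (V s / 2) * a)) \<longlongrightarrow> exp (V s) * K / (2 * t) * 0) at_top"
    by (intro tendsto_mult_left filterlim_compose[OF exp_at_bot]
        filterlim_tendsto_neg_mult_at_bot[OF tendsto_const] filterlim_ident) (use Vs in auto)
  then have "eventually (\<lambda>a. exp (V s) * K / (2 * t) * exp (- (V s / 2) * a) < e/2) at_top"
    using e by (intro order_tendstoD) auto
  then show "eventually (\<lambda>a. dist (gibbs_mean V a W) 0 < e) at_top"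
    using eventually_gt_at_top[of 1]
  proof eventually_elim
    case (elim a)
    have "gibbs_mean V a W \<ge> 0" unfolding gibbs_mean_def
      using partition_fn_pos[OF V, of a] elim Wnn by (intro divide_nonneg_nonneg integral_nonneg_AE) auto
    moreover have "gibbs_mean V a W < e" using Kle[OF elim(2)] elim(1) by linarith
    ultimately show ?case by (simp add: dist_real_def)
  qed
qed

text \<open>Intermediate value theorem between \<open>c\<close> and a parameter so large that the
  mean is below \<open>R\<close>. Having \<open>a \<ge> c\<close> keeps the parameter in the range
  where the mean of the second weight is controlled.\<close>

lemma gibbs_parameter_exists:
  assumes V: "orlicz V" and c: "c > 0" and R: "0 < R" "R \<le> gibbs_mean V c V"
  obtains a where "a \<ge> c" "gibbs_mean V a V = R"
proof -
  have "((\<lambda>a. gibbs_mean V a V) \<longlongrightarrow> 0) at_top"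
    by (rule gibbs_mean_tendsto_0[OF V V integrable_orlicz_exp[OF V]])
  then have "eventually (\<lambda>a. gibbs_mean V a V < R \<and> c \<le> a) at_top"
    using R(1) by (intro eventually_conj order_tendstoD eventually_ge_at_top)
  then obtain b where b: "gibbs_mean V b V < R" "c \<le> b"
    by (auto dest: eventually_happens)
  have "\<exists>a\<ge>c. a \<le> b \<and> gibbs_mean V a V = R"
    using b R continuous_on_subset[OF continuous_on_gibbs_mean[OF V c], of "{c..b}"]
    by (intro IVT2') auto
  then show ?thesis using that by blast
qed

section \<open>Products of Gibbs measures and volumes\<close>

definition gibbs :: "(real \<Rightarrow> real) \<Rightarrow> real \<Rightarrow> real measure" where
  "gibbs V a = density lborel (\<lambda>x. ennreal (exp (- a * V x) / partition_fn V a))"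

definition gibbs_prod :: "(real \<Rightarrow> real) \<Rightarrow> real \<Rightarrow> nat \<Rightarrow> (nat \<Rightarrow> real) measure" where
  "gibbs_prod V a n = PiM {..<n} (\<lambda>_. gibbs V a)"

text \<open>One body for both laws: \<open>W = V1\<close> gives the intersection of the two balls,
  and \<open>W = 0\<close> gives the ball of \<open>V\<close> alone.\<close>

definition orlicz_section :: "(real \<Rightarrow> real) \<Rightarrow> (real \<Rightarrow> real) \<Rightarrow> real \<Rightarrow> nat \<Rightarrow> (nat \<Rightarrow> real) set" where
  "orlicz_section V W R n =
     {x \<in> space (Rn n). (\<Sum>i<n. V (x i)) \<le> R * real n \<and> (\<Sum>i<n. W (x i)) \<le> real n}"

text \<open>It suffices to compare boxes, whose indicator factorises, so that the integral over the
  product splits.\<close>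

lemma PiM_density:
  fixes f :: "'i \<Rightarrow> 'a \<Rightarrow> ennreal"
  assumes "product_sigma_finite M" and "product_sigma_finite (\<lambda>i. density (M i) (f i))"
    and I: "finite I" and f[measurable]: "\<And>i. f i \<in> borel_measurable (M i)"
  shows "PiM I (\<lambda>i. density (M i) (f i)) = density (PiM I M) (\<lambda>x. \<Prod>i\<in>I. f i (x i))"
proof -
  interpret M: product_sigma_finite M by fact
  interpret D: product_sigma_finite "\<lambda>i. density (M i) (f i)" by fact
  show ?thesis
  proof (rule D.PiM_eqI[OF I, symmetric])
    show "sets (density (Pi\<^sub>M I M) (\<lambda>x. \<Prod>i\<in>I. f i (x i))) = sets (Pi\<^sub>M I (\<lambda>i. density (M i) (f i)))"
      by (auto intro!: sets_PiM_cong)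
    fix A assume "\<And>i. i \<in> I \<Longrightarrow> A i \<in> sets (density (M i) (f i))"
    then have A: "\<And>i. i \<in> I \<Longrightarrow> A i \<in> sets (M i)" by simp
    have PA: "Pi\<^sub>E I A \<in> sets (Pi\<^sub>M I M)" using A I by (intro sets_PiM_I_finite) auto
    have "emeasure (density (Pi\<^sub>M I M) (\<lambda>x. \<Prod>i\<in>I. f i (x i))) (Pi\<^sub>E I A) =
        (\<integral>\<^sup>+x. (\<Prod>i\<in>I. f i (x i)) * indicator (Pi\<^sub>E I A) x \<partial>Pi\<^sub>M I M)"
      using PA by (subst emeasure_density) (auto intro!: borel_measurable_prod_ennreal)
    also have "\<dots> = (\<integral>\<^sup>+x. (\<Prod>i\<in>I. f i (x i) * indicator (A i) (x i)) \<partial>Pi\<^sub>M I M)"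
    proof (rule nn_integral_cong)
      fix x assume x: "x \<in> space (Pi\<^sub>M I M)"
      then have "indicator (Pi\<^sub>E I A) x = (\<Prod>i\<in>I. indicator (A i) (x i) :: ennreal)"
        using I by (cases "x \<in> Pi\<^sub>E I A") (auto simp: space_PiM PiE_iff indicator_def intro!: prod_zero[symmetric])
      then show "(\<Prod>i\<in>I. f i (x i)) * indicator (Pi\<^sub>E I A) x = (\<Prod>i\<in>I. f i (x i) * indicator (A i) (x i))"
        by (simp add: prod.distrib)
    qed
    also have "\<dots> = (\<Prod>i\<in>I. \<integral>\<^sup>+x. f i x * indicator (A i) x \<partial>M i)"
      using A I by (subst M.product_nn_integral_prod) auto
    also have "\<dots> = (\<Prod>i\<in>I. emeasure (density (M i) (f i)) (A i))"
      using A by (intro prod.cong refl) (auto simp: emeasure_density)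
    finally show "emeasure (density (Pi\<^sub>M I M) (\<lambda>x. \<Prod>i\<in>I. f i (x i))) (Pi\<^sub>E I A) =
        (\<Prod>i\<in>I. emeasure (density (M i) (f i)) (A i))" .
  qed
qed

lemma emeasure_density_le:
  assumes [measurable]: "f \<in> borel_measurable M" "g \<in> borel_measurable M" "S \<in> sets M"
    and le: "\<And>x. x \<in> S \<Longrightarrow> f x \<le> c * g x"
  shows "emeasure (density M f) S \<le> c * emeasure (density M g) S"
proof -
  have "emeasure (density M f) S = (\<integral>\<^sup>+x. f x * indicator S x \<partial>M)"
    by (simp add: emeasure_density)
  also have "\<dots> \<le> (\<integral>\<^sup>+x. c * (g x * indicator S x) \<partial>M)"
    using le by (intro nn_integral_mono) (auto simp: indicator_def)
  also have "\<dots> = c * emeasure (density M g) S"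
    by (simp add: emeasure_density nn_integral_cmult)
  finally show ?thesis .
qed

lemma measurable_coord_sum:
  fixes f :: "real \<Rightarrow> real"
  assumes "f \<in> borel_measurable borel"
  shows "(\<lambda>x. \<Sum>i<n. f (x i)) \<in> borel_measurable (Rn n)"
proof (rule borel_measurable_sum)
  fix i assume i: "i \<in> {..<n}"
  show "(\<lambda>x. f (x i)) \<in> borel_measurable (Rn n)"
    unfolding Rn_def using assms
    by (intro measurable_compose[OF measurable_component_singleton[OF i], of f]) simp
qed

lemma sets_gibbs[simp, measurable_cong]: "sets (gibbs V a) = sets borel"
  by (simp add: gibbs_def)

lemma sets_gibbs_prod: "sets (gibbs_prod V a n) = sets (Rn n)"
  unfolding gibbs_prod_def Rn_def by (intro sets_PiM_cong) auto

lemma space_gibbs_prod: "space (gibbs_prod V a n) = space (Rn n)"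
  by (rule sets_eq_imp_space_eq[OF sets_gibbs_prod])

lemma prob_space_gibbs:
  assumes V: "orlicz V" and a: "a > 0" shows "prob_space (gibbs V a)"
proof
  note orlicz_measurable[OF V, measurable]
  have Z: "partition_fn V a > 0" by (rule partition_fn_pos[OF V a])
  have "emeasure (gibbs V a) (space (gibbs V a)) = (\<integral>\<^sup>+x. ennreal (exp (- a * V x) / partition_fn V a) \<partial>lborel)"
    by (simp add: gibbs_def emeasure_density)
  also have "\<dots> = ennreal (\<integral>x. exp (- a * V x) / partition_fn V a \<partial>lborel)"
    using integrable_exp_orlicz[OF V a] Z by (intro nn_integral_eq_integral) auto
  also have "(\<integral>x. exp (- a * V x) / partition_fn V a \<partial>lborel) = partition_fn V a / partition_fn V a"
    unfolding partition_fn_def by simp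
  also have "\<dots> = 1" using Z by simp
  finally show "emeasure (gibbs V a) (space (gibbs V a)) = 1" by simp
qed

lemma prob_space_gibbs_prod:
  assumes "orlicz V" and "a > 0" shows "prob_space (gibbs_prod V a n)"
  unfolding gibbs_prod_def by (intro prob_space_PiM prob_space_gibbs assms)

text \<open>The density depends on \<open>x\<close> only through the sum of the
  \<open>V (x i)\<close>; on a level set of this sum the product measure is thus a multiple of
  volume.\<close>

lemma gibbs_prod_eq_density:
  assumes V: "orlicz V" and a: "a > 0"
  shows "gibbs_prod V a n =
    density (Rn n) (\<lambda>x. ennreal (exp (- a * (\<Sum>i<n. V (x i))) / partition_fn V a ^ n))"
proof -
  note orlicz_measurable[OF V, measurable]
  have Z: "partition_fn V a > 0" by (rule partition_fn_pos[OF V a])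
  interpret G: prob_space "gibbs V a" by (rule prob_space_gibbs[OF V a])
  have "gibbs_prod V a n = density (Rn n) (\<lambda>x. \<Prod>i<n. ennreal (exp (- a * V (x i)) / partition_fn V a))"
    unfolding gibbs_prod_def Rn_def gibbs_def
  proof (rule PiM_density)
    show "product_sigma_finite (\<lambda>_. lborel :: real measure)"
      by (intro product_sigma_finite.intro lborel.sigma_finite_measure_axioms)
    show "product_sigma_finite (\<lambda>_. density lborel (\<lambda>x. ennreal (exp (- a * V x) / partition_fn V a)))"
      unfolding gibbs_def[symmetric] by (intro product_sigma_finite.intro G.sigma_finite_measure_axioms)
  qed auto
  also have "(\<lambda>x::nat \<Rightarrow> real. \<Prod>i<n. ennreal (exp (- a * V (x i)) / partition_fn V a)) =
      (\<lambda>x. ennreal (exp (- a * (\<Sum>i<n. V (x i))) / partition_fn V a ^ n))"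
    using Z by (auto simp: prod_ennreal prod_dividef sum_distrib_left sum_negf simp flip: exp_sum)
  finally show ?thesis .
qed

section \<open>Changes of measure between volume and Gibbs products\<close>

lemma measurable_gibbs_prod_density:
  assumes V: "orlicz V"
  shows "(\<lambda>x. ennreal (exp (- a * (\<Sum>i<n. V (x i))) / partition_fn V a ^ n)) \<in> borel_measurable (Rn n)"
proof -
  note measurable_coord_sum[OF orlicz_measurable[OF V], measurable]
  show ?thesis by measurable
qed

text \<open>Where the sum of the \<open>V (x i)\<close> is at most \<open>r n\<close>, the density
  is at least the inverse of the constant in front.\<close>

lemma emeasure_Rn_le_gibbs_prod:
  assumes V: "orlicz V" and a: "a > 0" and S: "S \<in> sets (Rn n)"
    and le: "\<And>x. x \<in> S \<Longrightarrow> (\<Sum>i<n. V (x i)) \<le> r * real n"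
  shows "emeasure (Rn n) S \<le> ennreal ((partition_fn V a * exp (a * r)) ^ n) * emeasure (gibbs_prod V a n) S"
proof -
  have Z: "partition_fn V a > 0" by (rule partition_fn_pos[OF V a])
  have "emeasure (density (Rn n) (\<lambda>_. 1)) S \<le> ennreal ((partition_fn V a * exp (a * r)) ^ n) *
      emeasure (density (Rn n) (\<lambda>x. ennreal (exp (- a * (\<Sum>i<n. V (x i))) / partition_fn V a ^ n))) S"
  proof (rule emeasure_density_le[OF _ measurable_gibbs_prod_density[OF V] S])
    fix x assume "x \<in> S"
    then have "a * (\<Sum>i<n. V (x i)) \<le> a * (r * real n)" using a le by (intro mult_left_mono) auto
    then have "1 \<le> exp (a * r * real n - a * (\<Sum>i<n. V (x i)))" by (simp add: mult_ac)
    also have "\<dots> = (partition_fn V a * exp (a * r)) ^ n * (exp (- a * (\<Sum>i<n. V (x i))) / partition_fn V a ^ n)"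
      using Z by (simp add: power_mult_distrib exp_diff exp_minus exp_of_nat2_mult divide_simps)
    finally show "1 \<le> ennreal ((partition_fn V a * exp (a * r)) ^ n) *
        ennreal (exp (- a * (\<Sum>i<n. V (x i))) / partition_fn V a ^ n)"
      using Z by (simp add: ennreal_mult[symmetric] del: ennreal_1 flip: ennreal_1)
  qed simp
  then show ?thesis by (simp add: density_1 gibbs_prod_eq_density[OF V a])
qed

text \<open>The reverse comparison: where the sum is at least \<open>r n\<close>, the density is at
  most the inverse of the constant. It turns Gibbs probabilities into lower bounds for
  volumes.\<close>

lemma emeasure_Rn_ge_gibbs_prod:
  assumes V: "orlicz V" and a: "a > 0" and S: "S \<in> sets (Rn n)"
    and ge: "\<And>x. x \<in> S \<Longrightarrow> (\<Sum>i<n. V (x i)) \<ge> r * real n"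
  shows "ennreal ((partition_fn V a * exp (a * r)) ^ n) * emeasure (gibbs_prod V a n) S \<le> emeasure (Rn n) S"
proof -
  have Z: "partition_fn V a > 0" by (rule partition_fn_pos[OF V a])
  define c where "c = (partition_fn V a * exp (a * r)) ^ n"
  have c: "c > 0" using Z by (simp add: c_def)
  have "emeasure (density (Rn n) (\<lambda>x. ennreal (exp (- a * (\<Sum>i<n. V (x i))) / partition_fn V a ^ n))) S \<le>
      ennreal (1 / c) * emeasure (density (Rn n) (\<lambda>_. 1)) S"
  proof (rule emeasure_density_le[OF measurable_gibbs_prod_density[OF V] _ S])
    fix x assume "x \<in> S"
    then have "a * (r * real n) \<le> a * (\<Sum>i<n. V (x i))" using a ge by (intro mult_left_mono) auto
    then have "exp (a * r * real n - a * (\<Sum>i<n. V (x i))) \<le> 1" by (simp add: mult_ac)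
    also have "exp (a * r * real n - a * (\<Sum>i<n. V (x i))) = c * (exp (- a * (\<Sum>i<n. V (x i))) / partition_fn V a ^ n)"
      using Z by (simp add: c_def power_mult_distrib exp_diff exp_minus exp_of_nat2_mult divide_simps)
    finally have "exp (- a * (\<Sum>i<n. V (x i))) / partition_fn V a ^ n \<le> 1 / c" using c by (simp add: field_simps)
    then show "ennreal (exp (- a * (\<Sum>i<n. V (x i))) / partition_fn V a ^ n) \<le> ennreal (1 / c) * 1"
      by (simp add: ennreal_leI)
  qed simp
  then have "ennreal c * emeasure (gibbs_prod V a n) S \<le> ennreal c * (ennreal (1 / c) * emeasure (Rn n) S)"
    by (intro mult_left_mono) (auto simp: density_1 gibbs_prod_eq_density[OF V a])
  also have "\<dots> = emeasure (Rn n) S" using c by (simp add: ennreal_mult[symmetric] flip: mult.assoc)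
  finally show ?thesis by (simp add: c_def)
qed

text \<open>A Chernoff bound by change of parameter: the ratio of the two densities is bounded on
  \<open>S\<close> by the right-hand side. The factor \<open>b - a\<close> in the condition covers
  the upper tail for \<open>b > a\<close> and the lower tail for \<open>b < a\<close>. If
  \<open>r\<close> is the mean for \<open>a\<close>, the base is below 1 by
  \<open>partition_fn_strict_min\<close>.\<close>

lemma gibbs_prod_tail_bound:
  assumes V: "orlicz V" and a: "a > 0" and b: "b > 0" and S: "S \<in> sets (Rn n)"
    and le: "\<And>x. x \<in> S \<Longrightarrow> (b - a) * (r * real n) \<le> (b - a) * (\<Sum>i<n. V (x i))"
  shows "measure (gibbs_prod V b n) S \<le>
    ((partition_fn V a * exp (a * r)) / (partition_fn V b * exp (b * r))) ^ n"
proof -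
  have Z: "partition_fn V a > 0" "partition_fn V b > 0" using partition_fn_pos[OF V] a b by auto
  interpret A: prob_space "gibbs_prod V a n" by (rule prob_space_gibbs_prod[OF V a])
  interpret B: prob_space "gibbs_prod V b n" by (rule prob_space_gibbs_prod[OF V b])
  define c where "c = ((partition_fn V a * exp (a * r)) / (partition_fn V b * exp (b * r))) ^ n"
  have c: "c > 0" using Z by (simp add: c_def)
  have "emeasure (density (Rn n) (\<lambda>x. ennreal (exp (- b * (\<Sum>i<n. V (x i))) / partition_fn V b ^ n))) S \<le>
      ennreal c * emeasure (density (Rn n) (\<lambda>x. ennreal (exp (- a * (\<Sum>i<n. V (x i))) / partition_fn V a ^ n))) S"
  proof (rule emeasure_density_le[OF measurable_gibbs_prod_density[OF V] measurable_gibbs_prod_density[OF V] S])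
    fix x assume "x \<in> S"
    define s where "s = (\<Sum>i<n. V (x i))"
    have "exp (- b * s) \<le> exp (- a * s + (a * r * real n - b * r * real n))"
      using le[OF \<open>x \<in> S\<close>] by (simp add: s_def algebra_simps)
    also have "\<dots> = exp (- a * s) * (exp (a * r) ^ n / exp (b * r) ^ n)"
      by (simp add: exp_add exp_diff exp_of_nat2_mult exp_minus divide_simps)
    finally have "exp (- b * s) / partition_fn V b ^ n \<le> exp (- a * s) * (exp (a * r) ^ n / exp (b * r) ^ n) / partition_fn V b ^ n"
      using Z by (intro divide_right_mono) auto
    also have "\<dots> = c * (exp (- a * s) / partition_fn V a ^ n)"
      using Z by (simp add: c_def power_mult_distrib power_divide mult_ac)
    finally show "ennreal (exp (- b * s) / partition_fn V b ^ n) \<le> ennreal c * ennreal (exp (- a * s) / partition_fn V a ^ n)"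
      using c Z by (simp add: ennreal_mult[symmetric] ennreal_leI)
  qed
  then have "emeasure (gibbs_prod V b n) S \<le> ennreal c * emeasure (gibbs_prod V a n) S"
    by (simp add: gibbs_prod_eq_density[OF V a] gibbs_prod_eq_density[OF V b])
  also have "\<dots> \<le> ennreal c * 1" by (intro mult_left_mono A.measure_le_1) auto
  finally show ?thesis using c by (simp add: B.emeasure_eq_measure c_def)
qed

section \<open>Expectations under Gibbs measures and the volume of sections\<close>

lemma integral_gibbs:
  assumes V: "orlicz V" and a: "a > 0" and W[measurable]: "W \<in> borel_measurable borel"
  shows "(\<integral>x. W x \<partial>gibbs V a) = gibbs_mean V a W"
    and "integrable (gibbs V a) W \<longleftrightarrow> integrable lborel (\<lambda>x. W x * exp (- a * V x))"
proof -
  note orlicz_measurable[OF V, measurable]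
  have Z: "partition_fn V a > 0" by (rule partition_fn_pos[OF V a])
  have "(\<integral>x. W x \<partial>gibbs V a) = (\<integral>x. (exp (- a * V x) / partition_fn V a) * W x \<partial>lborel)"
    unfolding gibbs_def using Z by (subst integral_real_density) auto
  also have "\<dots> = (\<integral>x. W x * exp (- a * V x) / partition_fn V a \<partial>lborel)" by (simp add: mult_ac)
  finally show "(\<integral>x. W x \<partial>gibbs V a) = gibbs_mean V a W" by (simp add: gibbs_mean_def)
  have "integrable (gibbs V a) W \<longleftrightarrow> integrable lborel (\<lambda>x. (exp (- a * V x) / partition_fn V a) * W x)"
    unfolding gibbs_def using Z by (subst integrable_real_density) auto
  also have "\<dots> \<longleftrightarrow> integrable lborel (\<lambda>x. (1 / partition_fn V a) * (W x * exp (- a * V x)))"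
    by (simp add: mult_ac)
  also have "\<dots> \<longleftrightarrow> integrable lborel (\<lambda>x. W x * exp (- a * V x))" using Z by (subst integrable_mult_left_iff) auto
  finally show "integrable (gibbs V a) W \<longleftrightarrow> integrable lborel (\<lambda>x. W x * exp (- a * V x))" .
qed

lemma gibbs_prod_component:
  assumes V: "orlicz V" and a: "a > 0" and W[measurable]: "W \<in> borel_measurable borel" and i: "i < n"
  shows "(\<integral>x. W (x i) \<partial>gibbs_prod V a n) = gibbs_mean V a W"
    and "integrable lborel (\<lambda>x. W x * exp (- a * V x)) \<Longrightarrow> integrable (gibbs_prod V a n) (\<lambda>x. W (x i))"
proof -
  have d: "distr (gibbs_prod V a n) (gibbs V a) (\<lambda>x. x i) = gibbs V a"
    unfolding gibbs_prod_def using i by (intro distr_PiM_component prob_space_gibbs V a) auto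
  have m[measurable]: "(\<lambda>x. x i) \<in> measurable (gibbs_prod V a n) (gibbs V a)"
    unfolding gibbs_prod_def using i by (intro measurable_component_singleton) auto
  show "(\<integral>x. W (x i) \<partial>gibbs_prod V a n) = gibbs_mean V a W"
    unfolding integral_gibbs(1)[OF V a W, symmetric]
    using integral_distr[OF m, of W] by (simp add: d)
  show "integrable (gibbs_prod V a n) (\<lambda>x. W (x i))" if "integrable lborel (\<lambda>x. W x * exp (- a * V x))"
    using that unfolding integral_gibbs(2)[OF V a W, symmetric]
    using integrable_distr_eq[OF m, of W] by (simp add: d)
qed

lemma sets_orlicz_section:
  assumes "V \<in> borel_measurable borel" "W \<in> borel_measurable borel"
  shows "orlicz_section V W R n \<in> sets (Rn n)"
proof -
  note assms[THEN measurable_coord_sum, measurable]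
  show ?thesis unfolding orlicz_section_def by measurable
qed

text \<open>The sum has expectation \<open>n\<close> times the one-dimensional mean, so Markov's
  inequality at level \<open>n\<close> gives a bound that does not depend on
  \<open>n\<close>.\<close>

lemma gibbs_prod_markov:
  assumes V: "orlicz V" and b: "b > 0" and W: "W \<in> borel_measurable borel" and Wnn: "\<And>x. W x \<ge> 0"
    and int: "integrable lborel (\<lambda>x. W x * exp (- b * V x))" and n: "n > 0"
  shows "measure (gibbs_prod V b n) {x \<in> space (Rn n). (\<Sum>i<n. W (x i)) \<ge> real n} \<le> gibbs_mean V b W"
proof -
  have ii: "integrable (gibbs_prod V b n) (\<lambda>x. \<Sum>i<n. W (x i))"
    by (intro Bochner_Integration.integrable_sum gibbs_prod_component(2)[OF V b W _ int]) auto
  have "measure (gibbs_prod V b n) {x \<in> space (gibbs_prod V b n). (\<Sum>i<n. W (x i)) \<ge> real n}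
      \<le> (\<integral>x. (\<Sum>i<n. W (x i)) \<partial>gibbs_prod V b n) / real n"
    using n Wnn by (intro integral_Markov_inequality_measure[OF ii, of "{}"]) (auto intro!: sum_nonneg)
  also have "(\<integral>x. (\<Sum>i<n. W (x i)) \<partial>gibbs_prod V b n) = (\<Sum>i<n. gibbs_mean V b W)"
    by (subst Bochner_Integration.integral_sum)
       (auto simp: gibbs_prod_component(1)[OF V b W] intro!: gibbs_prod_component(2)[OF V b W _ int])
  finally show ?thesis using n by (simp add: space_gibbs_prod)
qed

text \<open>
  For \<open>b\<close> strictly between \<open>a\<close> and some \<open>c > a\<close>, the sum of the \<open>V (x i)\<close> lies between \<open>n\<close> times the
  mean for \<open>c\<close> and \<open>n R\<close> with \<open>b\<close>-probability tending to 1. Both tails are estimated by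
  comparison with the parameter for which the threshold is the mean.
\<close>

lemma orlicz_section_volume_lower_bound:
  assumes V: "orlicz V" and a: "a > 0" and mean: "gibbs_mean V a V = R"
    and W: "W \<in> borel_measurable borel" and Wnn: "\<And>x. W x \<ge> 0"
    and int: "\<And>b. b > 0 \<Longrightarrow> integrable lborel (\<lambda>x. W x * exp (- b * V x))"
    and half: "\<And>b. b \<ge> a \<Longrightarrow> gibbs_mean V b W \<le> 1/2"
    and e: "e > 0"
  shows "eventually (\<lambda>n. ennreal ((exp (- e) * (partition_fn V a * exp (a * R))) ^ n)
      \<le> emeasure (Rn n) (orlicz_section V W R n)) sequentially"
proof -
  note VM = orlicz_measurable[OF V]
  \<comment> \<open>Moving the threshold from \<open>R\<close> down to the mean \<open>r\<close> for
    \<open>c\<close> costs a rate of at most \<open>c * (R - r)\<close>; by continuity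
    \<open>c > a\<close> can be taken so close to \<open>a\<close> that this is below
    \<open>e/2\<close>.\<close>
  have "continuous_on {a..} (\<lambda>c. c * (R - gibbs_mean V c V))"
    by (intro continuous_intros continuous_on_gibbs_mean V a)
  then have "((\<lambda>c. c * (R - gibbs_mean V c V)) \<longlongrightarrow> a * (R - gibbs_mean V a V)) (at a within {a..})"
    by (auto simp: continuous_on_def)
  then have "((\<lambda>c. c * (R - gibbs_mean V c V)) \<longlongrightarrow> 0) (at_right a)"
    using mean tendsto_within_subset[where T = "{a<..}"] by fastforce
  then have "eventually (\<lambda>c. c * (R - gibbs_mean V c V) < e/2 \<and> a < c) (at_right a)"
    using e by (intro eventually_conj order_tendstoD eventually_at_right_less) auto
  then obtain c where c: "c * (R - gibbs_mean V c V) < e/2" "a < c"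
    using eventually_happens[of _ "at_right a"] by auto
  define r where "r = gibbs_mean V c V"
  define b where "b = (a + c) / 2"
  have b: "a < b" "b < c" "b > 0" "c > 0" using c a by (auto simp: b_def)
  have r: "r < R" "r > 0" "R > 0"
    using gibbs_mean_strict_antimono[OF V a c(2)] gibbs_mean_pos[OF V] mean b a by (auto simp: r_def)
  define G where "G = (\<lambda>a r. partition_fn V a * exp (a * r))"
  have Gpos: "G x y > 0" if "x > 0" for x y using partition_fn_pos[OF V that] by (simp add: G_def)
  have G1: "G a R < G b R" unfolding G_def
    using b a r mean by (intro partition_fn_strict_min V) auto
  have G2: "G c r < G b r" unfolding G_def
    using b a r by (intro partition_fn_strict_min V) (auto simp: r_def)
  define q1 q2 where "q1 = G a R / G b R" and "q2 = G c r / G b r"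
  have q: "0 \<le> q1" "q1 < 1" "0 \<le> q2" "q2 < 1"
    using G1 G2 Gpos[of a] Gpos[of b] Gpos[of c] a b by (auto simp: q1_def q2_def less_imp_le)
  have "((\<lambda>n. q1 ^ n + q2 ^ n) \<longlonglongrightarrow> 0 + 0)"
    using q by (intro tendsto_add LIMSEQ_realpow_zero) auto
  then have ev1: "eventually (\<lambda>n. q1 ^ n + q2 ^ n < 1/4) sequentially" by (intro order_tendstoD) auto
  have "((\<lambda>n. exp (- e / 2) ^ n) \<longlonglongrightarrow> 0)" using e by (intro LIMSEQ_realpow_zero) auto
  then have ev2: "eventually (\<lambda>n. exp (- e / 2) ^ n < 1/4) sequentially" by (intro order_tendstoD) auto
  show ?thesis using ev1 ev2 eventually_gt_at_top[of 0]
  proof eventually_elim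
    case (elim n)
    interpret P: prob_space "gibbs_prod V b n" by (rule prob_space_gibbs_prod[OF V b(3)])
    note measurable_coord_sum[OF VM, measurable] measurable_coord_sum[OF W, measurable]
    define S1 where "S1 = {x \<in> space (Rn n). (\<Sum>i<n. V (x i)) \<ge> R * real n}"
    define S2 where "S2 = {x \<in> space (Rn n). (\<Sum>i<n. V (x i)) \<le> r * real n}"
    define S3 where "S3 = {x \<in> space (Rn n). (\<Sum>i<n. W (x i)) \<ge> real n}"
    \<comment> \<open>The lower restriction on the sum is what
      \<open>emeasure_Rn_ge_gibbs_prod\<close> requires.\<close>
    define S where "S = {x \<in> orlicz_section V W R n. (\<Sum>i<n. V (x i)) \<ge> r * real n}"
    have sets: "S1 \<in> sets (Rn n)" "S2 \<in> sets (Rn n)" "S3 \<in> sets (Rn n)" "S \<in> sets (Rn n)"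
      unfolding S1_def S2_def S3_def S_def orlicz_section_def by measurable
    have sets': "S1 \<in> P.events" "S2 \<in> P.events" "S3 \<in> P.events" "S \<in> P.events"
      using sets by (auto simp: sets_gibbs_prod)
    have "P.prob S1 \<le> q1 ^ n" unfolding q1_def G_def
    proof (rule gibbs_prod_tail_bound[OF V a b(3) sets(1)])
      fix x assume "x \<in> S1"
      then show "(b - a) * (R * real n) \<le> (b - a) * (\<Sum>i<n. V (x i))"
        using b by (intro mult_left_mono) (auto simp: S1_def)
    qed
    moreover have "P.prob S2 \<le> q2 ^ n" unfolding q2_def G_def
    proof (rule gibbs_prod_tail_bound[OF V b(4) b(3) sets(2)])
      fix x assume "x \<in> S2"
      then show "(b - c) * (r * real n) \<le> (b - c) * (\<Sum>i<n. V (x i))"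
        using b by (intro mult_left_mono_neg) (auto simp: S2_def)
    qed
    moreover have "P.prob S3 \<le> 1/2" unfolding S3_def
      using gibbs_prod_markov[OF V b(3) W Wnn int[OF b(3)] elim(3)] half[of b] b by simp
    moreover have "space (gibbs_prod V b n) \<subseteq> S \<union> (S1 \<union> (S2 \<union> S3))"
      by (auto simp: S_def S1_def S2_def S3_def orlicz_section_def space_gibbs_prod)
    then have "P.prob (space (gibbs_prod V b n)) \<le> P.prob (S \<union> (S1 \<union> (S2 \<union> S3)))"
      using sets' by (intro P.finite_measure_mono) auto
    then have "1 \<le> P.prob S + (P.prob S1 + (P.prob S2 + P.prob S3))"
      using sets' measure_Un_le[of S "gibbs_prod V b n" "S1 \<union> (S2 \<union> S3)"]
        measure_Un_le[of S1 "gibbs_prod V b n" "S2 \<union> S3"]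
        measure_Un_le[of S2 "gibbs_prod V b n" "S3"] by (simp add: P.prob_space)
    \<comment> \<open>The two tails together have probability below 1/4 and Markov's inequality
      contributes at most 1/2.\<close>
    ultimately have PS: "P.prob S \<ge> 1/4" using elim(1) by linarith
    \<comment> \<open>One half of \<open>e\<close> absorbs the factor 1/4, the other half pays for
      passing from \<open>G a R\<close> to \<open>G b r\<close>.\<close>
    have "(exp (- e) * G a R) ^ n = exp (- e / 2) ^ n * (exp (- e / 2) * G a R) ^ n"
      by (simp add: power_mult_distrib[symmetric] exp_add[symmetric] flip: mult.assoc)
    also have "\<dots> \<le> 1/4 * (exp (- e / 2) * G a R) ^ n"
      using elim(2) Gpos[OF a, of R] by (intro mult_right_mono) auto
    also have "\<dots> \<le> 1/4 * G b r ^ n"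
    proof (intro mult_left_mono power_mono)
      have "b * (R - r) \<le> c * (R - r)" using b r by (intro mult_right_mono) auto
      then have "- e/2 \<le> - (b * (R - r))" using c(1) by (simp add: r_def)
      then have "exp (- e / 2) * G a R \<le> exp (- (b * (R - r))) * G b R"
        using G1 Gpos[OF a, of R] by (intro mult_mono) auto
      also have "\<dots> = G b r" by (simp add: G_def exp_add[symmetric] algebra_simps)
      finally show "exp (- e / 2) * G a R \<le> G b r" .
    qed (use Gpos[OF a, of R] in auto)
    also have "\<dots> \<le> G b r ^ n * P.prob S" using PS Gpos[OF b(3), of r] by simp
    finally have "ennreal ((exp (- e) * G a R) ^ n) \<le> ennreal (G b r ^ n) * emeasure (gibbs_prod V b n) S"
      using Gpos[OF b(3), of r] by (simp add: P.emeasure_eq_measure ennreal_mult[symmetric] ennreal_leI)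
    also have "\<dots> \<le> emeasure (Rn n) S"
      unfolding G_def by (intro emeasure_Rn_ge_gibbs_prod V b sets) (auto simp: S_def)
    also have "\<dots> \<le> emeasure (Rn n) (orlicz_section V W R n)"
      by (intro emeasure_mono sets_orlicz_section VM W) (auto simp: S_def)
    finally show ?case by (simp add: G_def)
  qed
qed

section \<open>Blocks of coordinates\<close>

text \<open>The preimage of a box is the box with permuted sides. The factors are only sigma-finite
  because the lemma is applied to Lebesgue measure.\<close>

lemma distr_PiM_permute:
  fixes N :: "'a measure"
  assumes "sigma_finite_measure N" and I: "finite I" and \<pi>: "bij_betw \<pi> I I"
  shows "distr (PiM I (\<lambda>_. N)) (PiM I (\<lambda>_. N)) (\<lambda>x. \<lambda>i\<in>I. x (\<pi> i)) = PiM I (\<lambda>_. N)"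
proof -
  interpret N: sigma_finite_measure N by fact
  interpret P: product_sigma_finite "\<lambda>_. N" by (intro product_sigma_finite.intro assms)
  define \<sigma> where "\<sigma> = inv_into I \<pi>"
  have \<sigma>: "bij_betw \<sigma> I I" unfolding \<sigma>_def by (rule bij_betw_inv_into[OF \<pi>])
  have \<pi>I: "\<pi> i \<in> I" if "i \<in> I" for i using \<pi> that by (auto simp: bij_betw_def)
  have \<sigma>I: "\<sigma> i \<in> I" if "i \<in> I" for i using \<sigma> that by (auto simp: bij_betw_def)
  have \<sigma>\<pi>: "\<sigma> (\<pi> i) = i" if "i \<in> I" for i
    using \<pi> that unfolding \<sigma>_def by (simp add: bij_betw_inv_into_left)
  have \<pi>\<sigma>: "\<pi> (\<sigma> i) = i" if "i \<in> I" for i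
    using \<pi> that unfolding \<sigma>_def by (simp add: bij_betw_inv_into_right)
  let ?T = "\<lambda>x. \<lambda>i\<in>I. x (\<pi> i)"
  have T: "?T \<in> measurable (PiM I (\<lambda>_. N)) (PiM I (\<lambda>_. N))"
    using \<pi>I by (intro measurable_restrict measurable_component_singleton) auto
  show ?thesis
  proof (rule P.PiM_eqI[OF I])
    fix A assume A: "\<And>i. i \<in> I \<Longrightarrow> A i \<in> sets N"
    have sp: "x \<in> space N" if "i \<in> I" "x \<in> A i" for i x using A[OF that(1)] sets.sets_into_space that(2) by auto
    have eq: "?T -` Pi\<^sub>E I A \<inter> space (PiM I (\<lambda>_. N)) = Pi\<^sub>E I (\<lambda>i. A (\<sigma> i))"
    proof (intro set_eqI iffI)
      fix x assume x: "x \<in> ?T -` Pi\<^sub>E I A \<inter> space (PiM I (\<lambda>_. N))"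
      then have "x (\<pi> i) \<in> A i" if "i \<in> I" for i using that by (auto simp: PiE_iff)
      then have "x i \<in> A (\<sigma> i)" if "i \<in> I" for i using \<sigma>I[OF that] \<pi>\<sigma>[OF that] by metis
      then show "x \<in> Pi\<^sub>E I (\<lambda>i. A (\<sigma> i))" using x by (auto simp: PiE_iff space_PiM)
    next
      fix x assume x: "x \<in> Pi\<^sub>E I (\<lambda>i. A (\<sigma> i))"
      then have "x (\<pi> i) \<in> A i" if "i \<in> I" for i
        using that \<pi>I[OF that] \<sigma>\<pi>[OF that] by (metis PiE_mem)
      moreover have "x i \<in> space N" if "i \<in> I" for i using x sp[OF \<sigma>I[OF that]] that by (auto simp: PiE_iff)
      ultimately show "x \<in> ?T -` Pi\<^sub>E I A \<inter> space (PiM I (\<lambda>_. N))"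
        using x by (auto simp: PiE_iff space_PiM)
    qed
    have "emeasure (distr (PiM I (\<lambda>_. N)) (PiM I (\<lambda>_. N)) ?T) (Pi\<^sub>E I A) = emeasure (PiM I (\<lambda>_. N)) (Pi\<^sub>E I (\<lambda>i. A (\<sigma> i)))"
      using A I by (subst emeasure_distr[OF T]) (auto simp: eq intro!: sets_PiM_I_finite)
    also have "\<dots> = (\<Prod>i\<in>I. emeasure N (A (\<sigma> i)))"
      using A I \<sigma>I by (intro P.emeasure_PiM) auto
    also have "\<dots> = (\<Prod>i\<in>I. emeasure N (A i))"
      by (rule prod.reindex_bij_betw[OF \<sigma>])
    finally show "emeasure (distr (PiM I (\<lambda>_. N)) (PiM I (\<lambda>_. N)) ?T) (Pi\<^sub>E I A) = (\<Prod>i\<in>I. emeasure N (A i))" .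
  qed simp
qed

text \<open>With coordinate permutations for \<open>T\<close> and a symmetric body for
  \<open>C\<close>, this is the exchangeability of the uniform distribution.\<close>

lemma distr_uniform_measure_invariant:
  assumes T: "T \<in> measurable M M" and inv: "distr M M T = M"
    and C: "C \<in> sets M" "T -` C \<inter> space M = C"
  shows "distr (uniform_measure M C) (uniform_measure M C) T = uniform_measure M C"
proof (rule measure_eqI)
  fix A assume "A \<in> sets (distr (uniform_measure M C) (uniform_measure M C) T)"
  then have A: "A \<in> sets M" by simp
  have T': "T \<in> measurable (uniform_measure M C) (uniform_measure M C)" using T by simp
  have TA: "T -` A \<inter> space M \<in> sets M" by (rule measurable_sets[OF T A])
  have "emeasure (distr (uniform_measure M C) (uniform_measure M C) T) A = emeasure (uniform_measure M C) (T -` A \<inter> space M)"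
    using A by (subst emeasure_distr[OF T']) auto
  also have "\<dots> = emeasure M (C \<inter> (T -` A \<inter> space M)) / emeasure M C"
    by (rule emeasure_uniform_measure[OF C(1) TA])
  also have "C \<inter> (T -` A \<inter> space M) = T -` (C \<inter> A) \<inter> space M" using C(2) by auto
  also have "emeasure M \<dots> = emeasure (distr M M T) (C \<inter> A)"
    using A C(1) by (subst emeasure_distr[OF T]) auto
  also have "\<dots> / emeasure M C = emeasure (uniform_measure M C) A"
    by (simp add: inv emeasure_uniform_measure[OF C(1) A])
  finally show "emeasure (distr (uniform_measure M C) (uniform_measure M C) T) A = emeasure (uniform_measure M C) A" .
qed simp

text \<open>The stride is \<open>Suc k\<close> instead of \<open>k\<close> so that the case \<open>k = 0\<close> needs no special treatment.\<close>

definition block :: "nat \<Rightarrow> nat \<Rightarrow> (nat \<Rightarrow> 'a) \<Rightarrow> nat \<Rightarrow> 'a" where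
  "block k j x = (\<lambda>i\<in>{..<k}. x (j * Suc k + i))"

lemma block_index_less:
  assumes "j < n div Suc k" "i < k" shows "j * Suc k + i < n"
proof -
  have "j * Suc k + i < Suc j * Suc k" using assms by simp
  also have "\<dots> \<le> (n div Suc k) * Suc k" using assms by (intro mult_right_mono) auto
  also have "\<dots> \<le> n" by (rule div_times_less_eq_dividend)
  finally show ?thesis .
qed

lemma indep_vars_PiM_coordinates:
  assumes N: "prob_space N" and I: "I \<noteq> {}"
  shows "prob_space.indep_vars (PiM I (\<lambda>_. N)) (\<lambda>_. N) (\<lambda>i x. x i) I"
proof -
  interpret P: prob_space "PiM I (\<lambda>_. N)" by (intro prob_space_PiM N)
  have "distr (PiM I (\<lambda>_. N)) (PiM I (\<lambda>_. N)) (\<lambda>x. \<lambda>i\<in>I. x i) = PiM I (\<lambda>_. N)"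
    using distr_PiM_reindex[where K = I and I = I and f = "\<lambda>i. i" and M = "\<lambda>_. N"] N by auto
  also have "\<dots> = PiM I (\<lambda>i. distr (PiM I (\<lambda>_. N)) N (\<lambda>x. x i))"
    by (intro PiM_cong refl distr_PiM_component[symmetric] N)
  finally show ?thesis
    by (subst P.indep_vars_iff_distr_eq_PiM'[OF I]) auto
qed

text \<open>The blocks use disjoint sets of coordinates, so the \<open>f (block k j x)\<close> are
  independent; each has mean \<open>\<mu>\<close> and values in \<open>[-1,1]\<close>, and
  Hoeffding's inequality applies.\<close>

lemma block_average_concentration:
  assumes N: "prob_space N" and m: "m = n div Suc k" "m > 0" and d: "d \<ge> 0"
    and f[measurable]: "f \<in> borel_measurable (PiM {..<k} (\<lambda>_. N))"
    and bnd: "\<And>x. \<bar>f x\<bar> \<le> (1::real)"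
  defines "P \<equiv> PiM {..<n} (\<lambda>_. N)"
  defines "\<mu> \<equiv> (\<integral>x. f x \<partial>PiM {..<k} (\<lambda>_. N))"
  shows "measure P {x \<in> space P. \<bar>(\<Sum>j<m. f (block k j x)) - real m * \<mu>\<bar> \<ge> d * real m} \<le> 2 * exp (- (real m * d\<^sup>2 / 2))"
proof -
  interpret P: prob_space P unfolding P_def by (intro prob_space_PiM N)
  have n: "{..<n} \<noteq> {}" using m by (cases n) auto
  define K where "K = (\<lambda>j. (\<lambda>i. j * Suc k + i) ` {..<k})"
  have idx: "j * Suc k + i < n" if "j < m" "i < k" for i j using block_index_less that m by simp
  have disj: "disjoint_family_on K {..<m}"
    unfolding disjoint_family_on_def
  proof (intro ballI impI)
    fix j j' :: nat assume "j \<noteq> j'"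
    \<comment> \<open>An index determines its block by division, since the offset satisfies
      \<open>i < k < Suc k\<close>.\<close>
    have "x div Suc k = j" if xK: "x \<in> K j" for x j
    proof -
      obtain i where "i < k" "x = j * Suc k + i" using xK by (auto simp: K_def)
      then show ?thesis by (metis add.commute div_less div_mult_self3 less_SucI nat.simps(3) plus_nat.add_0 add.right_neutral)
    qed
    then show "K j \<inter> K j' = {}" using \<open>j \<noteq> j'\<close> by blast
  qed
  have "P.indep_vars (\<lambda>j. PiM (K j) (\<lambda>_. N)) (\<lambda>j x. restrict (\<lambda>i. x i) (K j)) {..<m}"
    using indep_vars_PiM_coordinates[OF N n] idx unfolding P_def[symmetric]
    by (intro P.indep_vars_restrict[OF _ _ disj, where I = "{..<n}"]) (auto simp: K_def)
  then have "P.indep_vars (\<lambda>_. borel) (\<lambda>j x. f (block k j (restrict (\<lambda>i. x i) (K j)))) {..<m}"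
  proof (rule P.indep_vars_compose2)
    fix j
    have "(\<lambda>y. block k j y) \<in> measurable (PiM (K j) (\<lambda>_. N)) (PiM {..<k} (\<lambda>_. N))"
      unfolding block_def by (intro measurable_restrict measurable_component_singleton) (auto simp: K_def)
    then show "(\<lambda>y. f (block k j y)) \<in> borel_measurable (PiM (K j) (\<lambda>_. N))"
      by (rule measurable_compose[OF _ f])
  qed
  moreover have "block k j (restrict (\<lambda>i. x i) (K j)) = block k j x" for j and x :: "nat \<Rightarrow> 'a"
    unfolding block_def by (rule restrict_ext) (auto simp: K_def)
  ultimately have ind: "P.indep_vars (\<lambda>_. borel) (\<lambda>j x. f (block k j x)) {..<m}" by simp
  have ex: "P.expectation (\<lambda>x. f (block k j x)) = \<mu>" if "j < m" for j
  proof -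
    have bm: "block k j \<in> measurable P (PiM {..<k} (\<lambda>_. N))"
      unfolding block_def P_def using idx[OF that]
      by (intro measurable_restrict measurable_component_singleton) auto
    have "distr P (PiM {..<k} (\<lambda>_. N)) (block k j) = PiM {..<k} (\<lambda>_. N)"
      unfolding P_def block_def using idx[OF that] by (intro distr_PiM_reindex N) (auto simp: inj_on_def)
    then show ?thesis unfolding \<mu>_def using integral_distr[OF bm f] by simp
  qed
  interpret H: Hoeffding_ineq P "{..<m}" "\<lambda>j x. f (block k j x)" "\<lambda>_. - 1" "\<lambda>_. 1"
      "\<Sum>j\<in>{..<m}. P.expectation (\<lambda>x. f (block k j x))"
    using ind bnd by unfold_locales (auto simp: abs_le_iff minus_le_iff)
  have "P.prob {x \<in> space P. \<bar>(\<Sum>j<m. f (block k j x)) - (\<Sum>j<m. P.expectation (\<lambda>x. f (block k j x)))\<bar> \<ge> d * real m}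
      \<le> 2 * exp (- 2 * (d * real m)\<^sup>2 / (\<Sum>j<m. (1 - (- 1))\<^sup>2))"
    using d m by (intro H.Hoeffding_ineq_abs_ge) auto
  also have "(\<Sum>j<m. P.expectation (\<lambda>x. f (block k j x))) = real m * \<mu>" using ex by simp
  \<comment> \<open>The range of each summand has length 2, so the denominator is
    \<open>4 * m\<close>.\<close>
  also have "- 2 * (d * real m)\<^sup>2 / (\<Sum>j<m. (1 - (- 1))\<^sup>2) = - (real m * d\<^sup>2 / 2)"
    using m by (simp add: power2_eq_square)
  finally show ?thesis .
qed

lemma measurable_block:
  assumes "j < n div Suc k"
  shows "block k j \<in> measurable (Rn n) (Rn k)"
  unfolding block_def Rn_def using block_index_less[OF assms]
  by (intro measurable_restrict measurable_component_singleton) auto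

text \<open>A permutation that exchanges block \<open>j\<close> with block 0 preserves Lebesgue
  measure, and it preserves the body because both constraints are symmetric sums.\<close>

lemma integral_block_eq:
  fixes f :: "(nat \<Rightarrow> real) \<Rightarrow> real" and R :: real
  assumes V: "V \<in> borel_measurable borel" and W: "W \<in> borel_measurable borel"
    and f: "f \<in> borel_measurable (Rn k)" and j: "j < n div Suc k"
  defines "U \<equiv> uniform_measure (Rn n) (orlicz_section V W R n)"
  shows "(\<integral>x. f (block k j x) \<partial>U) = (\<integral>x. f (block k 0 x) \<partial>U)"
proof -
  define \<pi> where "\<pi> = (\<lambda>i. if i < k then j * Suc k + i
      else if j * Suc k \<le> i \<and> i < j * Suc k + k then i - j * Suc k else i)"
  have idx: "j * Suc k + i < n" if "i < k" for i using block_index_less[OF j that] .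
  have inv: "\<pi> (\<pi> i) = i" for i
  proof -
    \<comment> \<open>Either the two blocks coincide or they are disjoint; in both cases
      \<open>\<pi>\<close> is an involution.\<close>
    have "j * Suc k = 0 \<or> k < j * Suc k" by (cases j) auto
    then show ?thesis unfolding \<pi>_def by (auto simp del: mult_Suc_right mult_eq_0_iff)
  qed
  have im: "\<pi> i \<in> {..<n}" if "i \<in> {..<n}" for i using that idx by (auto simp: \<pi>_def)
  have bij: "bij_betw \<pi> {..<n} {..<n}"
    by (rule bij_betw_byWitness[where f' = \<pi>]) (use inv im in auto)
  let ?T = "\<lambda>x. \<lambda>i\<in>{..<n}. x (\<pi> i)"
  have T: "?T \<in> measurable (Rn n) (Rn n)"
    unfolding Rn_def using im by (intro measurable_restrict measurable_component_singleton) auto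
  have dT: "distr (Rn n) (Rn n) ?T = Rn n"
    unfolding Rn_def by (rule distr_PiM_permute[OF lborel.sigma_finite_measure_axioms _ bij]) simp
  have C: "orlicz_section V W R n \<in> sets (Rn n)" by (rule sets_orlicz_section[OF V W])
  have CT: "?T -` orlicz_section V W R n \<inter> space (Rn n) = orlicz_section V W R n"
  proof -
    have "(\<Sum>i<n. g (?T x i)) = (\<Sum>i<n. g (x i))" for g :: "real \<Rightarrow> real" and x
      using sum.reindex_bij_betw[OF bij, of "\<lambda>i. g (x i)"] by simp
    moreover have "?T x \<in> space (Rn n)" if "x \<in> space (Rn n)" for x
      using measurable_space[OF T that] .
    ultimately show ?thesis by (auto simp: orlicz_section_def)
  qed
  have dU: "distr U U ?T = U" unfolding U_def by (rule distr_uniform_measure_invariant[OF T dT C CT])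
  have m0: "0 < n div Suc k" using j by linarith
  have TU: "?T \<in> measurable U U" using T by (simp add: U_def)
  have f0: "(\<lambda>x. f (block k 0 x)) \<in> borel_measurable U"
    using measurable_compose[OF measurable_block[OF m0] f] by (simp add: U_def)
  have "(\<integral>x. f (block k 0 x) \<partial>U) = (\<integral>x. f (block k 0 x) \<partial>distr U U ?T)" by (simp add: dU)
  also have "\<dots> = (\<integral>x. f (block k 0 (?T x)) \<partial>U)" by (rule integral_distr[OF TU f0])
  also have "(\<lambda>x. f (block k 0 (?T x))) = (\<lambda>x. f (block k j x))"
  proof
    fix x :: "nat \<Rightarrow> real"
    have "block k 0 (?T x) = block k j x"
      unfolding block_def using block_index_less[OF m0]
      by (intro restrict_ext) (auto simp: \<pi>_def)
    then show "f (block k 0 (?T x)) = f (block k j x)" by simp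
  qed
  finally show ?thesis by simp
qed

section \<open>Convergence of the marginals\<close>

lemma measurable_first_coords:
  assumes "k \<le> n" and "sets U = sets (Rn n)"
  shows "(\<lambda>x. restrict x {..<k}) \<in> measurable U (Rn k)"
proof -
  have "(\<lambda>x. restrict x {..<k}) \<in> measurable (Rn n) (Rn k)"
    unfolding Rn_def using assms(1) by (intro measurable_restrict_subset) auto
  then show ?thesis using measurable_cong_sets[OF assms(2) refl] by auto
qed

lemma first_coords_eq_block:
  assumes "k \<le> n" and "f \<in> borel_measurable (Rn k)" and "sets U = sets (Rn n)"
  shows "(\<integral>x. f x \<partial>first_coords k U) = (\<integral>x. f (block k 0 x) \<partial>U :: real)"
  unfolding first_coords_def
  by (subst integral_distr[OF measurable_first_coords[OF assms(1,3)] assms(2)]) (simp add: block_def)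

lemma prob_space_first_coords:
  assumes "k \<le> n" and "sets U = sets (Rn n)" and "prob_space U"
  shows "prob_space (first_coords k U)"
  unfolding first_coords_def
  by (rule prob_space.prob_space_distr[OF assms(3) measurable_first_coords[OF assms(1,2)]])

text \<open>Comparison with a Gibbs probability; the parameter 1 is an arbitrary positive
  choice.\<close>

lemma emeasure_sublevel_finite:
  assumes V: "orlicz V" and S: "S \<in> sets (Rn n)" and le: "\<And>x. x \<in> S \<Longrightarrow> (\<Sum>i<n. V (x i)) \<le> r * real n"
  shows "emeasure (Rn n) S \<noteq> \<infinity>"
proof -
  interpret P: prob_space "gibbs_prod V 1 n" by (rule prob_space_gibbs_prod[OF V]) simp
  have "emeasure (Rn n) S \<le> ennreal ((partition_fn V 1 * exp (1 * r)) ^ n) * emeasure (gibbs_prod V 1 n) S"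
    by (rule emeasure_Rn_le_gibbs_prod[OF V _ S le]) auto
  also have "\<dots> < \<infinity>" by (simp add: ennreal_mult_less_top P.emeasure_eq_measure)
  finally show ?thesis by simp
qed

lemma abs_integral_le_1:
  assumes "prob_space \<mu>" and "\<And>x. \<bar>f x\<bar> \<le> (1::real)"
  shows "\<bar>\<integral>x. f x \<partial>\<mu>\<bar> \<le> 1"
\<comment> \<open>In the non-integrable case the Bochner integral is 0 by convention.\<close>
proof (cases "integrable \<mu> f")
  case True
  interpret prob_space \<mu> by fact
  have "\<bar>\<integral>x. f x \<partial>\<mu>\<bar> \<le> (\<integral>x. \<bar>f x\<bar> \<partial>\<mu>)" by (rule integral_abs_bound)
  also have "\<dots> \<le> (\<integral>x. 1 \<partial>\<mu>)" using assms True by (intro integral_mono) auto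
  finally show ?thesis by (simp add: prob_space)
qed (simp add: not_integrable_integral_eq)

lemma abs_integral_le_deviation:
  assumes "prob_space U" and Y[measurable]: "Y \<in> borel_measurable U"
    and bnd: "\<And>x. x \<in> space U \<Longrightarrow> \<bar>Y x\<bar> \<le> 2" and d: "d \<ge> 0"
  shows "\<bar>\<integral>x. Y x \<partial>U\<bar> \<le> d + 2 * measure U {x \<in> space U. \<bar>Y x\<bar> \<ge> d}"
proof -
  interpret prob_space U by fact
  have iY: "integrable U Y" using bnd by (intro integrable_const_bound[where B = 2]) auto
  have "\<bar>\<integral>x. Y x \<partial>U\<bar> \<le> (\<integral>x. \<bar>Y x\<bar> \<partial>U)" by (rule integral_abs_bound)
  also have "\<dots> \<le> (\<integral>x. d + 2 * indicator {x \<in> space U. \<bar>Y x\<bar> \<ge> d} x \<partial>U)"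
  proof (rule integral_mono)
    show "\<bar>Y x\<bar> \<le> d + 2 * indicator {x \<in> space U. \<bar>Y x\<bar> \<ge> d} x" if "x \<in> space U" for x
      using bnd[OF that] d that by (auto simp: indicator_def)
  qed (use iY in \<open>auto intro!: Bochner_Integration.integrable_add integrable_real_indicator simp: emeasure_eq_measure\<close>)
  also have "\<dots> = d + 2 * prob {x \<in> space U. \<bar>Y x\<bar> \<ge> d}"
    by (subst Bochner_Integration.integral_add)
       (auto simp: prob_space intro!: integrable_real_indicator simp: emeasure_eq_measure)
  finally show ?thesis .
qed

text \<open>Passing from the Gibbs product to the uniform distribution multiplies probabilities by
  at most \<open>exp (e * n)\<close>, which is less than the exponential concentration of block
  averages. Exchangeability then turns a block average into the integral over the first block. The
  threshold for \<open>n\<close> is common to all test functions \<open>f\<close>, since no estimate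
  depends on more than \<open>\<bar>f x\<bar> \<le> 1\<close>.\<close>

lemma orlicz_section_marginal_converges:
  fixes k :: nat and h :: real
  assumes V: "orlicz V" and a: "a > 0" and mean: "gibbs_mean V a V = R"
    and W: "W \<in> borel_measurable borel" and Wnn: "\<And>x. W x \<ge> 0"
    and int: "\<And>b. b > 0 \<Longrightarrow> integrable lborel (\<lambda>x. W x * exp (- b * V x))"
    and half: "\<And>b. b \<ge> a \<Longrightarrow> gibbs_mean V b W \<le> 1/2"
    and h: "h > 0"
  defines "\<mu> \<equiv> \<lambda>n. first_coords k (uniform_measure (Rn n) (orlicz_section V W R n))"
  shows "eventually (\<lambda>n. prob_space (\<mu> n) \<and> emeasure (Rn n) (orlicz_section V W R n) > 0 \<and>
      (\<forall>f. f \<in> borel_measurable (Rn k) \<and> (\<forall>x. \<bar>f x\<bar> \<le> 1) \<longrightarrow>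
        \<bar>(\<integral>x. f x \<partial>\<mu> n) - (\<integral>x. f x \<partial>gibbs_prod V a k)\<bar> \<le> h)) sequentially"
proof -
  note VM = orlicz_measurable[OF V]
  define d where "d = h / 2"
  have d: "d > 0" using h by (simp add: d_def)
  \<comment> \<open>This is half of the rate per coordinate, \<open>d^2 / (2 * (k + 1))\<close>, in
    Hoeffding's inequality for blocks of stride \<open>k + 1\<close>; the other half remains for
    decay.\<close>
  define e where "e = d\<^sup>2 / (4 * real (Suc k))"
  have e: "e > 0" using d by (simp add: e_def)
  define G where "G = partition_fn V a * exp (a * R)"
  have G: "G > 0" using partition_fn_pos[OF V a] by (simp add: G_def)
  have "(\<lambda>n. 4 * exp (d\<^sup>2 / 2) * exp (- e) ^ n) \<longlonglongrightarrow> 4 * exp (d\<^sup>2 / 2) * 0"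
    using e by (intro tendsto_mult_left LIMSEQ_realpow_zero) auto
  then have ev: "eventually (\<lambda>n. 4 * exp (d\<^sup>2 / 2) * exp (- e) ^ n < d) sequentially"
    using d by (intro order_tendstoD) auto
  have vol: "eventually (\<lambda>n. ennreal ((exp (- e) * (partition_fn V a * exp (a * R))) ^ n)
      \<le> emeasure (Rn n) (orlicz_section V W R n)) sequentially"
    by (rule orlicz_section_volume_lower_bound[OF V a mean W Wnn int half e])
  show ?thesis
    using ev vol eventually_ge_at_top[of "Suc k"]
  proof eventually_elim
    case (elim n)
    define C where "C = orlicz_section V W R n"
    have Cs: "C \<in> sets (Rn n)" unfolding C_def by (rule sets_orlicz_section[OF VM W])
    have Cle: "(\<Sum>i<n. V (x i)) \<le> R * real n" if "x \<in> C" for x using that by (simp add: C_def orlicz_section_def)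
    have Cfin: "emeasure (Rn n) C \<noteq> \<infinity>" by (rule emeasure_sublevel_finite[OF V Cs Cle])
    have low: "ennreal ((exp (- e) * G) ^ n) \<le> emeasure (Rn n) C" using elim(2) by (simp add: C_def G_def)
    have lowpos: "(exp (- e) * G) ^ n > 0" using G by simp
    have Cpos: "emeasure (Rn n) C > 0" using low lowpos
      by (metis ennreal_less_zero_iff less_le_trans)
    define U where "U = uniform_measure (Rn n) C"
    have Usets: "sets U = sets (Rn n)" and Uspace: "space U = space (Rn n)" by (auto simp: U_def)
    interpret U: prob_space U unfolding U_def using Cpos Cfin by (intro prob_space_uniform_measure) auto
    interpret P: prob_space "gibbs_prod V a n" by (rule prob_space_gibbs_prod[OF V a])
    interpret Pk: prob_space "gibbs_prod V a k" by (rule prob_space_gibbs_prod[OF V a])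
    \<comment> \<open>The part of \<open>B\<close> in \<open>C\<close> has volume at most
      \<open>G ^ n\<close> times the Gibbs probability of \<open>B\<close>, while \<open>C\<close>
      has volume at least \<open>(exp (- e) * G) ^ n\<close>; the powers of \<open>G\<close>
      cancel.\<close>
    have Ule: "U.prob B \<le> exp e ^ n * P.prob B" if B: "B \<in> sets (Rn n)" for B
    proof -
      have CB: "C \<inter> B \<in> sets (Rn n)" using Cs B by auto
      have "emeasure (Rn n) (C \<inter> B) \<le> ennreal (G ^ n) * emeasure (gibbs_prod V a n) (C \<inter> B)"
        unfolding G_def by (rule emeasure_Rn_le_gibbs_prod[OF V a CB]) (use Cle in auto)
      also have "\<dots> \<le> ennreal (G ^ n) * emeasure (gibbs_prod V a n) B"
        using B by (intro mult_left_mono emeasure_mono) (auto simp: sets_gibbs_prod)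
      finally have "emeasure (Rn n) (C \<inter> B) \<le> ennreal (G ^ n * P.prob B)"
        using G by (simp add: P.emeasure_eq_measure ennreal_mult)
      then have 1: "measure (Rn n) (C \<inter> B) \<le> G ^ n * P.prob B"
        unfolding measure_def using G by (intro enn2real_leI) auto
      have 2: "(exp (- e) * G) ^ n \<le> measure (Rn n) C"
        using low Cfin lowpos by (simp add: emeasure_eq_ennreal_measure ennreal_le_iff)
      have "U.prob B = measure (Rn n) (C \<inter> B) / measure (Rn n) C"
        unfolding U_def using Cpos Cfin B by (intro measure_uniform_measure) auto
      also have "\<dots> \<le> (G ^ n * P.prob B) / (exp (- e) * G) ^ n"
        using 1 2 lowpos G by (intro frac_le) auto
      also have "\<dots> = exp e ^ n * P.prob B"
        using G by (simp add: power_mult_distrib exp_minus power_inverse divide_simps)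
      finally show ?thesis .
    qed
    have prob: "prob_space (\<mu> n)"
      unfolding \<mu>_def C_def[symmetric] U_def[symmetric]
      using elim(3) by (intro prob_space_first_coords[OF _ Usets] U.prob_space_axioms) auto
    define m where "m = n div Suc k"
    have m: "m > 0" using elim(3) by (simp add: m_def div_greater_zero_iff)
    have mn: "real n / real (Suc k) - 1 \<le> real m"
    proof -
      have "n < Suc k * (m + 1)" unfolding m_def using dividend_less_times_div[of "Suc k" n] by simp
      then have "real n < real (Suc k) * (real m + 1)" by (metis of_nat_1 of_nat_add of_nat_less_iff of_nat_mult)
      then show ?thesis by (simp add: field_simps)
    qed
    have "\<bar>(\<integral>x. f x \<partial>\<mu> n) - (\<integral>x. f x \<partial>gibbs_prod V a k)\<bar> \<le> h"
      if f: "f \<in> borel_measurable (Rn k)" and fb: "\<And>x. \<bar>f x\<bar> \<le> 1" for f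
    proof -
      define \<nu> where "\<nu> = (\<integral>x. f x \<partial>gibbs_prod V a k)"
      have fk: "f \<in> borel_measurable (gibbs_prod V a k)"
        using f by (simp add: measurable_cong_sets[OF sets_gibbs_prod refl])
      have \<nu>: "\<bar>\<nu>\<bar> \<le> 1" unfolding \<nu>_def by (rule abs_integral_le_1[OF Pk.prob_space_axioms fb])
      have Xm: "(\<lambda>x. f (block k j x)) \<in> borel_measurable (Rn n)" if "j < m" for j
        using measurable_compose[OF measurable_block f] that by (simp add: m_def)
      then have XU: "(\<lambda>x. f (block k j x)) \<in> borel_measurable U" if "j < m" for j
        using that measurable_cong_sets[OF Usets refl] by auto
      have Xi: "integrable U (\<lambda>x. f (block k j x))" if "j < m" for j
        using XU[OF that] fb by (intro U.integrable_const_bound[where B = 1]) auto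
      define Y where "Y = (\<lambda>x. (\<Sum>j<m. f (block k j x)) / real m - \<nu>)"
      have Ym: "Y \<in> borel_measurable U" unfolding Y_def
        by (intro borel_measurable_diff borel_measurable_divide borel_measurable_sum XU) auto
      \<comment> \<open>All blocks have the same integral under \<open>U\<close>, so the average has
        the integral of block 0.\<close>
      have EY: "(\<integral>x. Y x \<partial>U) = (\<integral>x. f (block k 0 x) \<partial>U) - \<nu>"
      proof -
        have "(\<integral>x. (\<Sum>j<m. f (block k j x)) / real m \<partial>U) = (\<Sum>j<m. \<integral>x. f (block k j x) \<partial>U) / real m"
          using Xi by simp
        also have "(\<Sum>j<m. \<integral>x. f (block k j x) \<partial>U) = (\<Sum>j<m. \<integral>x. f (block k 0 x) \<partial>U)"
          unfolding U_def C_def m_def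
          by (intro sum.cong refl integral_block_eq[OF VM W f]) auto
        finally have "(\<integral>x. (\<Sum>j<m. f (block k j x)) / real m \<partial>U) = (\<integral>x. f (block k 0 x) \<partial>U)"
          using m by simp
        then show ?thesis unfolding Y_def using Xi
          by (subst Bochner_Integration.integral_diff)
             (auto simp: U.prob_space intro!: integrable_divide_zero Bochner_Integration.integrable_sum)
      qed
      have Yb: "\<bar>Y x\<bar> \<le> 2" for x
      proof -
        have "\<bar>\<Sum>j<m. f (block k j x)\<bar> \<le> (\<Sum>j<m. 1)" by (rule order_trans[OF sum_abs sum_mono]) (rule fb)
        then have "\<bar>(\<Sum>j<m. f (block k j x)) / real m\<bar> \<le> 1" using m by (simp add: abs_div)
        then show ?thesis unfolding Y_def using \<nu> by linarith
      qed
      define B where "B = {x \<in> space U. \<bar>Y x\<bar> \<ge> d}"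
      have "\<bar>\<integral>x. Y x \<partial>U\<bar> \<le> d + 2 * U.prob B"
        unfolding B_def using d Yb by (intro abs_integral_le_deviation U.prob_space_axioms Ym) auto
      also have "U.prob B \<le> exp e ^ n * P.prob B"
      proof (rule Ule)
        have "B \<in> sets U" unfolding B_def using Ym by measurable
        then show "B \<in> sets (Rn n)" by (simp add: Usets)
      qed
      also have "B = {x \<in> space (gibbs_prod V a n). \<bar>(\<Sum>j<m. f (block k j x)) - real m * \<nu>\<bar> \<ge> d * real m}"
      proof -
        have "\<bar>Y x\<bar> = \<bar>(\<Sum>j<m. f (block k j x)) - real m * \<nu>\<bar> / real m" for x
        proof -
          have "Y x = ((\<Sum>j<m. f (block k j x)) - real m * \<nu>) / real m"
            unfolding Y_def using m by (simp add: diff_divide_distrib)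
          then show ?thesis by (simp add: abs_div)
        qed
        then show ?thesis unfolding B_def Uspace space_gibbs_prod using m by (simp add: pos_le_divide_eq)
      qed
      also have "P.prob \<dots> \<le> 2 * exp (- (real m * d\<^sup>2 / 2))"
        unfolding \<nu>_def gibbs_prod_def
        by (rule block_average_concentration[OF prob_space_gibbs[OF V a] m_def m])
           (use d fb fk in \<open>auto simp: gibbs_prod_def\<close>)
      also have "d + 2 * (exp e ^ n * (2 * exp (- (real m * d\<^sup>2 / 2)))) = d + 4 * exp (real n * e - real m * d\<^sup>2 / 2)"
        by (simp add: exp_of_nat_mult[symmetric] exp_add[symmetric] flip: exp_diff)
      \<comment> \<open>Rounding in \<open>m = n div Suc k\<close> loses at most one block, at the
        cost of the factor \<open>exp (d^2 / 2)\<close>.\<close>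
      also have "\<dots> \<le> d + 4 * exp (d\<^sup>2 / 2 - real n * e)"
      proof -
        have "(real n / real (Suc k) - 1) * (d\<^sup>2 / 2) \<le> real m * (d\<^sup>2 / 2)"
          using mn by (intro mult_right_mono) auto
        moreover have "(real n / real (Suc k) - 1) * (d\<^sup>2 / 2) = 2 * (real n * e) - d\<^sup>2 / 2"
          unfolding e_def by (simp add: field_simps)
        ultimately show ?thesis by (simp add: mult_ac)
      qed
      also have "\<dots> = d + 4 * exp (d\<^sup>2 / 2) * exp (- e) ^ n"
        by (simp add: mult.assoc flip: exp_of_nat_mult exp_add)
      also have "\<dots> \<le> h" using elim(1) by (simp add: d_def)
      finally have "\<bar>(\<integral>x. f (block k 0 x) \<partial>U) - \<nu>\<bar> \<le> h" by (simp add: EY)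
      moreover have "(\<integral>x. f x \<partial>\<mu> n) = (\<integral>x. f (block k 0 x) \<partial>U)"
        unfolding \<mu>_def C_def[symmetric] U_def[symmetric]
        using elim(3) by (intro first_coords_eq_block[OF _ f Usets]) auto
      ultimately show ?thesis by (simp add: \<nu>_def)
    qed
    then show ?case using prob Cpos by (auto simp: C_def)
  qed
qed

text \<open>The difference of the integrals is at most the distance of the densities in L1, whatever
  \<open>f\<close> is, and this distance is continuous in the parameter by dominated
  convergence.\<close>

lemma gibbs_prod_continuous_parameter:
  fixes h :: real
  assumes V: "orlicz V" and a: "a > 0" and h: "h > 0"
  shows "eventually (\<lambda>b. \<forall>f. f \<in> borel_measurable (Rn k) \<and> (\<forall>x. \<bar>f x\<bar> \<le> 1) \<longrightarrow>
      \<bar>(\<integral>x. f x \<partial>gibbs_prod V b k) - (\<integral>x. f x \<partial>gibbs_prod V a k)\<bar> \<le> h) (nhds a)"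
proof -
  note measurable_coord_sum[OF orlicz_measurable[OF V], measurable]
  define g where "g = (\<lambda>b x. exp (- b * (\<Sum>i<k. V (x i))) / partition_fn V b ^ k)"
  have gm[measurable]: "g b \<in> borel_measurable (Rn k)" for b unfolding g_def by measurable
  have Z: "partition_fn V b > 0" if "b > 0" for b by (rule partition_fn_pos[OF V that])
  have gnn: "g b x \<ge> 0" if "b > 0" for b x using Z[OF that] by (simp add: g_def)
  have gP: "gibbs_prod V b k = density (Rn k) (\<lambda>x. ennreal (g b x))" if "b > 0" for b
    unfolding g_def by (rule gibbs_prod_eq_density[OF V that])
  have gi: "integrable (Rn k) (g b)" if b: "b > 0" for b
  proof (rule integrableI_nonneg)
    interpret P: prob_space "gibbs_prod V b k" by (rule prob_space_gibbs_prod[OF V b])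
    have "(\<integral>\<^sup>+ x. ennreal (g b x) \<partial>Rn k) = 1"
      using P.emeasure_space_1 by (simp add: gP[OF b] emeasure_density cong: nn_integral_cong)
    then show "(\<integral>\<^sup>+ x. ennreal (g b x) \<partial>Rn k) < \<infinity>" by simp
  qed (use gnn[OF b] in auto)
  define S where "S = {a/2<..<2*a}"
  have Spos: "b > 0" if "b \<in> S" for b using that a by (auto simp: S_def)
  \<comment> \<open>For parameters in \<open>S\<close> the exponential is largest at
    \<open>a/2\<close> and the normalising constant smallest at \<open>2*a\<close>. The factor 2
    allows for a difference of two densities.\<close>
  define w where "w = (\<lambda>x. 2 * ((partition_fn V (a/2) ^ k / partition_fn V (2*a) ^ k) * g (a/2) x))"
  have gw: "g b x \<le> w x / 2" if b: "b \<in> S" for b x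
  proof -
    have s: "(\<Sum>i<k. V (x i)) \<ge> 0" using V by (intro sum_nonneg) (auto simp: orlicz_def)
    have Zle: "partition_fn V (2*a) \<le> partition_fn V b"
      unfolding partition_fn_def using b a Spos[OF b]
      by (intro integral_mono integrable_exp_orlicz V exp_orlicz_antimono) (auto simp: S_def)
    have "g b x \<le> exp (- (a/2) * (\<Sum>i<k. V (x i))) / partition_fn V (2*a) ^ k"
      unfolding g_def
    proof (rule frac_le)
      show "exp (- b * (\<Sum>i<k. V (x i))) \<le> exp (- (a/2) * (\<Sum>i<k. V (x i)))"
        using mult_right_mono[OF _ s, of "a/2" b] b by (auto simp: S_def)
      show "partition_fn V (2*a) ^ k \<le> partition_fn V b ^ k"
        using Zle Z[of "2*a"] a by (intro power_mono) auto
    qed (use Z[of "2*a"] a in auto)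
    also have "\<dots> = w x / 2" using Z[of "a/2"] a by (simp add: w_def g_def)
    finally show ?thesis .
  qed
  define D where "D = (\<lambda>b. \<integral>x. \<bar>g b x - g a x\<bar> \<partial>Rn k)"
  have cont: "continuous_on S D" unfolding D_def
  proof (rule continuous_on_integral_dominated)
    show "integrable (Rn k) w" unfolding w_def using gi[of "a/2"] a by (intro integrable_mult_right) auto
    show "\<bar>\<bar>g b x - g a x\<bar>\<bar> \<le> w x" if "b \<in> S" for b x
      using gw[OF that, of x] gw[of a x] gnn[OF Spos[OF that], of x] gnn[OF a, of x] a by (auto simp: S_def)
    have "continuous_on S (partition_fn V)"
      by (rule continuous_on_subset[OF continuous_on_partition_fn[OF V, of "a/2"]]) (use a in \<open>auto simp: S_def\<close>)
    then show "continuous_on S (\<lambda>b. \<bar>g b x - g a x\<bar>)" for x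
      unfolding g_def using Z Spos by (intro continuous_intros) (auto, force)
  qed measurable
  have aS: "a \<in> S" "open S" using a by (auto simp: S_def)
  have "isCont D a" using cont aS by (simp add: continuous_on_eq_continuous_at)
  then have "(D \<longlongrightarrow> D a) (nhds a)"
    unfolding isCont_def by (rule tendsto_at_iff_tendsto_nhds[THEN iffD1])
  moreover have "D a = 0" by (simp add: D_def)
  ultimately have "eventually (\<lambda>b. D b < h) (nhds a)"
    using h by (intro order_tendstoD) auto
  moreover have "eventually (\<lambda>b. b \<in> S) (nhds a)" using aS by (intro eventually_nhds_in_open)
  ultimately show ?thesis
  proof eventually_elim
    case (elim b)
    have b: "b > 0" using Spos elim by auto
    show ?case
    proof (intro allI impI)
      fix f :: "(nat \<Rightarrow> real) \<Rightarrow> real"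
      assume f: "f \<in> borel_measurable (Rn k) \<and> (\<forall>x. \<bar>f x\<bar> \<le> 1)"
      then have [measurable]: "f \<in> borel_measurable (Rn k)" and fb: "\<And>x. \<bar>f x\<bar> \<le> 1" by auto
      have fi: "integrable (Rn k) (\<lambda>x. g c x * f x)" if c: "c > 0" for c
        by (rule Bochner_Integration.integrable_bound[OF gi[OF c]])
           (use gnn[OF c] fb in \<open>auto simp: abs_mult mult_left_le\<close>)
      have int: "(\<integral>x. f x \<partial>gibbs_prod V c k) = (\<integral>x. g c x * f x \<partial>Rn k)" if c: "c > 0" for c
        unfolding gP[OF c] using gnn[OF c] by (subst integral_real_density) auto
      have "\<bar>(\<integral>x. f x \<partial>gibbs_prod V b k) - (\<integral>x. f x \<partial>gibbs_prod V a k)\<bar> = \<bar>\<integral>x. g b x * f x - g a x * f x \<partial>Rn k\<bar>"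
        using fi[OF a] fi[OF b] by (simp add: int a b)
      also have "\<dots> \<le> (\<integral>x. \<bar>g b x * f x - g a x * f x\<bar> \<partial>Rn k)" by (rule integral_abs_bound)
      also have "\<dots> \<le> (\<integral>x. \<bar>g b x - g a x\<bar> \<partial>Rn k)"
      proof (rule integral_mono)
        fix x
        have "\<bar>g b x * f x - g a x * f x\<bar> = \<bar>g b x - g a x\<bar> * \<bar>f x\<bar>"
          by (simp add: abs_mult[symmetric] algebra_simps)
        also have "\<dots> \<le> \<bar>g b x - g a x\<bar> * 1" using fb by (intro mult_left_mono) auto
        finally show "\<bar>g b x * f x - g a x * f x\<bar> \<le> \<bar>g b x - g a x\<bar>" by simp
      qed (use fi[OF a] fi[OF b] gi[OF a] gi[OF b] in auto)
      finally show "\<bar>(\<integral>x. f x \<partial>gibbs_prod V b k) - (\<integral>x. f x \<partial>gibbs_prod V a k)\<bar> \<le> h"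
        using elim(1) by (simp add: D_def)
    qed
  qed
qed

section \<open>The bounded-Lipschitz distance\<close>

text \<open>Conditioning twice is conditioning on the intersection, because the volume of
  \<open>A\<close> cancels. If the intersection is null, both sides vanish, as
  \<open>0 / 0 = 0\<close> in \<open>ennreal\<close>.\<close>

lemma uniform_measure_uniform_measure:
  assumes A: "A \<in> sets M" and B: "B \<in> sets M" and pos: "emeasure M A \<noteq> 0" and fin: "emeasure M A \<noteq> \<infinity>"
  shows "uniform_measure (uniform_measure M A) B = uniform_measure M (A \<inter> B)"
proof (rule measure_eqI)
  fix X assume "X \<in> sets (uniform_measure (uniform_measure M A) B)"
  then have X: "X \<in> sets M" by simp
  have finAX: "emeasure M (A \<inter> Y) \<noteq> \<infinity>" if "Y \<in> sets M" for Y
    using emeasure_mono[of "A \<inter> Y" A M] A fin by (auto simp: top_unique)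
  obtain u where u: "emeasure M A = ennreal u" "u > 0"
    using pos fin by (cases "emeasure M A") (auto simp: less_le)
  obtain v where v: "emeasure M (A \<inter> B) = ennreal v" "v \<ge> 0"
    using finAX[OF B] by (cases "emeasure M (A \<inter> B)") auto
  obtain w where w: "emeasure M (A \<inter> (B \<inter> X)) = ennreal w" "w \<ge> 0"
    using finAX[of "B \<inter> X"] B X by (cases "emeasure M (A \<inter> (B \<inter> X))") auto
  have wv: "w \<le> v" using emeasure_mono[of "A \<inter> (B \<inter> X)" "A \<inter> B" M] A B v w by (auto simp: ennreal_le_iff)
  have "emeasure (uniform_measure (uniform_measure M A) B) X = (ennreal w / ennreal u) / (ennreal v / ennreal u)"
    using A B X u v w by (simp add: emeasure_uniform_measure)
  also have "\<dots> = ennreal w / ennreal v"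
  proof (cases "v = 0")
    case True
    then have "w = 0" using wv w by simp
    then show ?thesis by simp
  qed (use u v w in \<open>simp add: divide_ennreal\<close>)
  also have "\<dots> = emeasure (uniform_measure M (A \<inter> B)) X"
    using A B X v w by (simp add: emeasure_uniform_measure Int_assoc)
  finally show "emeasure (uniform_measure (uniform_measure M A) B) X = emeasure (uniform_measure M (A \<inter> B)) X" .
qed simp

lemma lam_unif_eq: "lam_unif V n k R = first_coords k (uniform_measure (Rn n) (orlicz_section V (\<lambda>_. 0) R n))"
  by (simp add: lam_unif_def orlicz_ball_def orlicz_section_def)

text \<open>Positive volume of the section forces positive volume of the ball of \<open>V1\<close>,
  which is also finite; the two conditionings then merge.\<close>

lemma lam_cond_eq:
  assumes V1: "orlicz V1" and V2: "orlicz V2" and pos: "emeasure (Rn n) (orlicz_section V2 V1 (R + \<epsilon>) n) > 0"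
  shows "lam_cond V1 V2 n k R \<epsilon> = first_coords k (uniform_measure (Rn n) (orlicz_section V2 V1 (R + \<epsilon>) n))"
proof -
  note [measurable] = V1[THEN orlicz_measurable, THEN measurable_coord_sum]
    V2[THEN orlicz_measurable, THEN measurable_coord_sum]
  have A: "orlicz_ball V1 n 1 \<in> sets (Rn n)" "orlicz_ball V2 n (R + \<epsilon>) \<in> sets (Rn n)"
    unfolding orlicz_ball_def by measurable
  have eq: "orlicz_ball V1 n 1 \<inter> orlicz_ball V2 n (R + \<epsilon>) = orlicz_section V2 V1 (R + \<epsilon>) n"
    by (auto simp: orlicz_ball_def orlicz_section_def)
  have "emeasure (Rn n) (orlicz_ball V1 n 1) \<noteq> \<infinity>"
    by (rule emeasure_sublevel_finite[OF V1 A(1), of 1]) (simp add: orlicz_ball_def)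
  moreover have "emeasure (Rn n) (orlicz_ball V1 n 1) > 0"
    using pos emeasure_mono[of "orlicz_section V2 V1 (R + \<epsilon>) n" "orlicz_ball V1 n 1" "Rn n"] A eq
    by (auto intro: less_le_trans)
  ultimately show ?thesis
    unfolding lam_cond_def by (subst uniform_measure_uniform_measure[OF A]) (auto simp: eq)
qed

section \<open>Estimates for the supremum over test functions\<close>

definition dBL_test :: "nat \<Rightarrow> ((nat \<Rightarrow> real) \<Rightarrow> real) set" where
  "dBL_test k = {f. f \<in> borel_measurable (Rn k) \<and> (\<forall>x. \<bar>f x\<bar> \<le> 1)
        \<and> (\<forall>x y. \<bar>f x - f y\<bar> \<le> sqrt (\<Sum>i<k. (x i - y i)\<^sup>2))}"

lemma dBL_eq: "dBL k \<mu> \<nu> = (SUP f\<in>dBL_test k. \<bar>(\<integral>x. f x \<partial>\<mu>) - (\<integral>x. f x \<partial>\<nu>)\<bar>)"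
  by (simp add: dBL_def dBL_test_def)

lemma zero_in_dBL_test: "(\<lambda>_. 0) \<in> dBL_test k"
  by (simp add: dBL_test_def sum_nonneg)

lemma bdd_above_dBL:
  assumes "prob_space \<mu>" "prob_space \<nu>"
  shows "bdd_above ((\<lambda>f. \<bar>(\<integral>x. f x \<partial>\<mu>) - (\<integral>x. f x \<partial>\<nu>)\<bar>) ` dBL_test k)"
proof (rule bdd_aboveI2)
  fix f assume "f \<in> dBL_test k"
  then have "\<bar>f x\<bar> \<le> 1" for x by (auto simp: dBL_test_def)
  from abs_integral_le_1[OF assms(1), of f, OF this] abs_integral_le_1[OF assms(2), of f, OF this] show "\<bar>(\<integral>x. f x \<partial>\<mu>) - (\<integral>x. f x \<partial>\<nu>)\<bar> \<le> 2" by linarith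
qed

lemma dBL_nonneg:
  assumes "prob_space \<mu>" "prob_space \<nu>" shows "dBL k \<mu> \<nu> \<ge> 0"
  unfolding dBL_eq by (rule cSUP_upper2[OF bdd_above_dBL[OF assms] zero_in_dBL_test]) simp

lemma dBL_le:
  assumes "\<And>f. f \<in> dBL_test k \<Longrightarrow> \<bar>(\<integral>x. f x \<partial>\<mu>) - (\<integral>x. f x \<partial>\<nu>)\<bar> \<le> h"
  shows "dBL k \<mu> \<nu> \<le> h"
  unfolding dBL_eq using zero_in_dBL_test assms by (intro cSUP_least) auto

text \<open>A triangle inequality, test function by test function. The supremum has to be bounded
  only for the primed pair, so either pair can take that place when the estimate is used in both
  directions.\<close>

lemma dBL_le_perturb:
  assumes "prob_space \<mu>'" "prob_space \<nu>'"
    and "\<And>f. f \<in> dBL_test k \<Longrightarrow> \<bar>(\<integral>x. f x \<partial>\<mu>) - (\<integral>x. f x \<partial>\<mu>')\<bar> \<le> h"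
    and "\<And>f. f \<in> dBL_test k \<Longrightarrow> \<bar>(\<integral>x. f x \<partial>\<nu>) - (\<integral>x. f x \<partial>\<nu>')\<bar> \<le> h"
  shows "dBL k \<mu> \<nu> \<le> dBL k \<mu>' \<nu>' + 2 * h"
proof (rule dBL_le)
  fix f assume f: "f \<in> dBL_test k"
  have "\<bar>(\<integral>x. f x \<partial>\<mu>') - (\<integral>x. f x \<partial>\<nu>')\<bar> \<le> dBL k \<mu>' \<nu>'"
    unfolding dBL_eq by (rule cSUP_upper[OF f bdd_above_dBL[OF assms(1,2)]])
  then show "\<bar>(\<integral>x. f x \<partial>\<mu>) - (\<integral>x. f x \<partial>\<nu>)\<bar> \<le> dBL k \<mu>' \<nu>' + 2 * h"
    using assms(3)[OF f] assms(4)[OF f] by linarith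
qed

section \<open>The limits in the dimension and in the enlargement of the radius\<close>

theorem theoremB:
  fixes V1 V2 :: "real \<Rightarrow> real"
  assumes "orlicz V1" and "orlicz V2"
    and "filterlim (\<lambda>x. V1 x / V2 x) at_top at_infinity"
    and "\<forall>\<alpha>::real. \<alpha> < 0 \<longrightarrow> integrable lborel (\<lambda>x. V1 x * exp (\<alpha> * V2 x))"
  shows "\<exists>Rbar>0. \<forall>R. 0 < R \<and> R \<le> Rbar \<longrightarrow> (\<forall>k::nat. \<exists>L :: real \<Rightarrow> real.
           (\<forall>\<^sub>F \<epsilon> in at_right 0.
              ((\<lambda>n. dBL k (lam_cond V1 V2 n k R \<epsilon>) (lam_unif V2 n k R)) \<longlonglongrightarrow> L \<epsilon>))
           \<and> (L \<longlongrightarrow> 0) (at_right 0))"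
proof -
  note V1 = assms(1) and V2 = assms(2)
  have int: "integrable lborel (\<lambda>x. V1 x * exp (- b * V2 x))" if "b > 0" for b
    using assms(4) that by (metis neg_less_0_iff_less)
  have V1nn: "V1 x \<ge> 0" for x using V1 by (auto simp: orlicz_def)
  have "eventually (\<lambda>b. gibbs_mean V2 b V1 < 1/2) at_top"
    by (rule order_tendstoD[OF gibbs_mean_tendsto_0[OF V2 V1 int]]) auto
  then obtain c0 where c0: "\<And>b. b \<ge> c0 \<Longrightarrow> gibbs_mean V2 b V1 < 1/2" by (auto simp: eventually_at_top_linorder)
  define c where "c = max c0 1"
  have c: "c > 0" and half: "\<And>b. b \<ge> c \<Longrightarrow> gibbs_mean V2 b V1 \<le> 1/2"
    using c0 by (auto simp: c_def intro: less_imp_le)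
  define m where "m = (\<lambda>b. gibbs_mean V2 b V2)"
  have anti: "m y < m x" if "x > 0" "x < y" for x y
    unfolding m_def by (rule gibbs_mean_strict_antimono[OF V2 that])
  \<comment> \<open>The bound on \<open>R\<close> is \<open>m (c + 1)\<close> and not
    \<open>m c\<close>, so that \<open>R + \<epsilon>\<close> still has a parameter at least
    \<open>c\<close> for small \<open>\<epsilon>\<close>.\<close>
  have "\<exists>L. (\<forall>\<^sub>F \<epsilon> in at_right 0. ((\<lambda>n. dBL k (lam_cond V1 V2 n k R \<epsilon>) (lam_unif V2 n k R)) \<longlonglongrightarrow> L \<epsilon>))
           \<and> (L \<longlongrightarrow> 0) (at_right 0)" if R: "0 < R" "R \<le> m (c + 1)" for R k
  proof -
    obtain a where a: "a \<ge> c + 1" "m a = R"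
      using gibbs_parameter_exists[OF V2, of "c + 1" R] R c unfolding m_def by auto
    have a0: "a > 0" using a c by simp
    have mc: "R < m c" using anti[of c "c + 1"] c R by simp
    \<comment> \<open>The parameter with mean \<open>R + \<epsilon>\<close>; it exists for
      \<open>0 < \<epsilon> < m c - R\<close> and is unique since \<open>m\<close> is strictly
      decreasing.\<close>
    define A where "A = (\<lambda>\<epsilon>. SOME b. b \<ge> c \<and> m b = R + \<epsilon>)"
    have A: "A \<epsilon> \<ge> c \<and> m (A \<epsilon>) = R + \<epsilon>" if \<epsilon>: "0 < \<epsilon>" "\<epsilon> < m c - R" for \<epsilon>
    proof -
      obtain b where "b \<ge> c" "m b = R + \<epsilon>"
        using gibbs_parameter_exists[OF V2 c, of "R + \<epsilon>"] \<epsilon> R unfolding m_def by auto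
      then show ?thesis unfolding A_def by (intro someI[of "\<lambda>b. b \<ge> c \<and> m b = R + \<epsilon>"]) auto
    qed
    have small: "eventually (\<lambda>\<epsilon>. 0 < \<epsilon> \<and> \<epsilon> < m l - R) (at_right 0)" if "m l > R" for l
      using that by (intro eventually_conj eventually_at_right_less order_tendstoD(2)[OF tendsto_ident_at]) auto
    have A_lim: "(A \<longlongrightarrow> a) (at_right 0)"
    proof (rule order_tendstoI)
      fix l assume l: "l < a"
      \<comment> \<open>Monotonicity of \<open>m\<close> is known for positive arguments only, hence
        the maximum with \<open>c\<close>.\<close>
      define l' where "l' = max l c"
      have l': "l' > 0" "l' < a" "l \<le> l'" using l a c by (auto simp: l'_def)
      have "m l' > R" using anti[OF l'(1,2)] a by simp
      from small[OF this] small[OF mc] show "eventually (\<lambda>\<epsilon>. l < A \<epsilon>) (at_right 0)"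
      proof eventually_elim
        case (elim \<epsilon>)
        have *: "A \<epsilon> \<ge> c" "m (A \<epsilon>) = R + \<epsilon>" using A[of \<epsilon>] elim by auto
        have "l' < A \<epsilon>"
        proof (rule ccontr)
          assume "\<not> ?thesis"
          then have "m l' \<le> m (A \<epsilon>)" using anti[of "A \<epsilon>" l'] * c by (cases "A \<epsilon> = l'") auto
          then show False using * elim by simp
        qed
        then show ?case using l' by simp
      qed
    next
      fix u assume u: "a < u"
      show "eventually (\<lambda>\<epsilon>. A \<epsilon> < u) (at_right 0)" using small[OF mc]
      proof eventually_elim
        case (elim \<epsilon>)
        have *: "m (A \<epsilon>) = R + \<epsilon>" using A[of \<epsilon>] elim by auto
        show ?case
        proof (rule ccontr)
          assume "\<not> ?thesis"
          then have "m (A \<epsilon>) < m a" using u a0 by (intro anti) auto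
          then show False using * a elim by simp
        qed
      qed
    qed
    define L where "L = (\<lambda>\<epsilon>. dBL k (gibbs_prod V2 (A \<epsilon>) k) (gibbs_prod V2 a k))"
    have "eventually (\<lambda>\<epsilon>. ((\<lambda>n. dBL k (lam_cond V1 V2 n k R \<epsilon>) (lam_unif V2 n k R)) \<longlonglongrightarrow> L \<epsilon>)) (at_right 0)"
      using small[OF mc]
    proof eventually_elim
      case (elim \<epsilon>)
      have A\<epsilon>: "A \<epsilon> \<ge> c" "gibbs_mean V2 (A \<epsilon>) V2 = R + \<epsilon>" and A0: "A \<epsilon> > 0"
        using A[of \<epsilon>] elim c by (auto simp: m_def)
      note P = prob_space_gibbs_prod[OF V2 A0, of k] prob_space_gibbs_prod[OF V2 a0, of k]
      show ?case
      proof (rule tendstoI)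
        fix h :: real assume h: "h > 0"
        \<comment> \<open>Each comparison of the two pairs of measures costs \<open>2 * h'\<close>,
          that is \<open>h/2\<close>.\<close>
        define h' where "h' = h / 4"
        have h': "h' > 0" using h by (simp add: h'_def)
        let ?\<mu> = "\<lambda>n. first_coords k (uniform_measure (Rn n) (orlicz_section V2 V1 (R + \<epsilon>) n))"
        let ?\<nu> = "\<lambda>n. first_coords k (uniform_measure (Rn n) (orlicz_section V2 (\<lambda>_. 0) R n))"
        have ev1: "eventually (\<lambda>n. prob_space (?\<mu> n) \<and> emeasure (Rn n) (orlicz_section V2 V1 (R + \<epsilon>) n) > 0 \<and>
            (\<forall>f. f \<in> borel_measurable (Rn k) \<and> (\<forall>x. \<bar>f x\<bar> \<le> 1) \<longrightarrow>
              \<bar>(\<integral>x. f x \<partial>?\<mu> n) - (\<integral>x. f x \<partial>gibbs_prod V2 (A \<epsilon>) k)\<bar> \<le> h')) sequentially"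
          using A\<epsilon>(1) half
          by (intro orlicz_section_marginal_converges V2 A0 A\<epsilon> orlicz_measurable[OF V1] V1nn int h') auto
        have ev2: "eventually (\<lambda>n. prob_space (?\<nu> n) \<and> emeasure (Rn n) (orlicz_section V2 (\<lambda>_. 0) R n) > 0 \<and>
            (\<forall>f. f \<in> borel_measurable (Rn k) \<and> (\<forall>x. \<bar>f x\<bar> \<le> 1) \<longrightarrow>
              \<bar>(\<integral>x. f x \<partial>?\<nu> n) - (\<integral>x. f x \<partial>gibbs_prod V2 a k)\<bar> \<le> h')) sequentially"
          \<comment> \<open>With weight 0 the second constraint is void and its mean is 0, so the
            bound by 1/2 holds.\<close>
          by (intro orlicz_section_marginal_converges V2 a0 a(2)[unfolded m_def] h') (auto simp: gibbs_mean_def)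
        from ev1 ev2 show "eventually (\<lambda>n. dist (dBL k (lam_cond V1 V2 n k R \<epsilon>) (lam_unif V2 n k R)) (L \<epsilon>) < h) sequentially"
        proof eventually_elim
          case (elim n)
          have lc: "lam_cond V1 V2 n k R \<epsilon> = ?\<mu> n" using elim by (intro lam_cond_eq V1 V2) auto
          have cl: "\<bar>(\<integral>x. f x \<partial>?\<mu> n) - (\<integral>x. f x \<partial>gibbs_prod V2 (A \<epsilon>) k)\<bar> \<le> h'"
            "\<bar>(\<integral>x. f x \<partial>?\<nu> n) - (\<integral>x. f x \<partial>gibbs_prod V2 a k)\<bar> \<le> h'" if "f \<in> dBL_test k" for f
            using elim that by (auto simp: dBL_test_def)
          have "dBL k (?\<mu> n) (?\<nu> n) \<le> L \<epsilon> + 2 * h'"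
            unfolding L_def by (rule dBL_le_perturb[OF P]) (use cl in auto)
          \<comment> \<open>The same estimate with the roles of the two pairs exchanged.\<close>
          moreover have "L \<epsilon> \<le> dBL k (?\<mu> n) (?\<nu> n) + 2 * h'"
            unfolding L_def by (rule dBL_le_perturb) (use cl elim in \<open>auto simp: abs_minus_commute\<close>)
          ultimately show ?case using h by (simp add: lc lam_unif_eq dist_real_def h'_def)
        qed
      qed
    qed
    moreover have "(L \<longlongrightarrow> 0) (at_right 0)"
    proof (rule tendstoI)
      fix h :: real assume h: "h > 0"
      have "eventually (\<lambda>\<epsilon>. \<forall>f. f \<in> borel_measurable (Rn k) \<and> (\<forall>x. \<bar>f x\<bar> \<le> 1) \<longrightarrow>
          \<bar>(\<integral>x. f x \<partial>gibbs_prod V2 (A \<epsilon>) k) - (\<integral>x. f x \<partial>gibbs_prod V2 a k)\<bar> \<le> h/2) (at_right 0)"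
        using h by (intro eventually_compose_filterlim[OF gibbs_prod_continuous_parameter A_lim] V2 a0) auto
      then show "eventually (\<lambda>\<epsilon>. dist (L \<epsilon>) 0 < h) (at_right 0)" using small[OF mc]
      proof eventually_elim
        case (elim \<epsilon>)
        have A0: "A \<epsilon> > 0" using A[of \<epsilon>] elim c by auto
        have "L \<epsilon> \<le> h/2" unfolding L_def using elim(1) by (intro dBL_le) (auto simp: dBL_test_def)
        moreover have "L \<epsilon> \<ge> 0" unfolding L_def by (intro dBL_nonneg prob_space_gibbs_prod V2 A0 a0)
        ultimately show ?case using h by (simp add: dist_real_def)
      qed
    qed
    ultimately show ?thesis by blast
  qed
  moreover have "m (c + 1) > 0" unfolding m_def using c by (intro gibbs_mean_pos V2) auto
  ultimately show ?thesis by blast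
qed

end
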